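(* Let $\alpha>0$ and $\kappa\in\mathbb{R}$ be constants independent of $n$, let $m=\alpha n$, and let $H$ be an $m\times n$ matrix with i.i.d. standard normal components. Define $$\xi_{\pm 1}=\min_{\mathbf{x}\in\mathbb{R}^n,\ \mathbf{x}_i^2=\frac1n,\ 1\le i\le n}\ \ \max_{\lambda\in\mathbb{R}^m,\ \|\lambda\|_2=1,\ \lambda_i\ge 0}\left(\kappa\lambda^T\mathbf{1}-\lambda^TH\mathbf{x}\right),$$ and $$f_{gar}(\kappa)=\frac{1}{\sqrt{2\pi}}\int_{-\kappa}^{\infty}(z+\kappa)^2e^{-\frac{z^2}{2}}\,dz=\frac{\kappa e^{-\frac{\kappa^2}{2}}}{\sqrt{2\pi}}+\frac{(\kappa^2+1)\,\mathrm{erfc}\left(-\frac{\kappa}{\sqrt2}\right)}{2}.$$ Let $\epsilon_1^{(m)},\epsilon_1^{(n)},\epsilon_5^{(g)}$ be arbitrarily small positive constants independent of $n$, and let $\xi_{\pm1}^{(l)}$ be a scalar (possibly depending on $n$) such that $$(1-\epsilon_1^{(m)})\sqrt{\alpha f_{gar}(\kappa)}-(1+\epsilon_1^{(n)})\sqrt{\frac{2}{\pi}}-\epsilon_5^{(g)}>\frac{\xi_{\pm1}^{(l)}}{\sqrt n}.$$ Then $$\lim_{n\to\infty}P\left(\xi_{\pm1}\ge \xi_{\pm1}^{(l)}\right)\geq 1$$ (that is, the limit equals $1$).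
   Context: $\mathbf{1}$ is the $m$-dimensional vector of all ones. $\mathrm{erfc}(x)=\frac{2}{\sqrt\pi}\int_x^\infty e^{-t^2}dt$. Probability is over the randomness of $H$. The regime is $n\to\infty$ with $m=\alpha n$ (rounded to an integer if necessary). *)

theory Defs
  imports "HOL-Probability.Probability"
begin

text \<open>
  The dimensions \<open>m\<close> and \<open>n\<close> vary inside a limit, so a vector of dimension \<open>n\<close> is an
  extensional function on \<open>{..<n}\<close>, and an \<open>m \<times> n\<close> matrix is a function of two indices of
  which only the entries with \<open>i < m\<close> and \<open>j < n\<close> are used.
\<close>

definition cube_pm1 :: "nat \<Rightarrow> (nat \<Rightarrow> real) set" where
  "cube_pm1 n = {x \<in> {..<n} \<rightarrow>\<^sub>E UNIV. \<forall>i<n. (x i)\<^sup>2 = 1 / real n}"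

definition nonneg_sphere :: "nat \<Rightarrow> (nat \<Rightarrow> real) set" where
  "nonneg_sphere m =
     {l \<in> {..<m} \<rightarrow>\<^sub>E UNIV. sqrt (\<Sum>i<m. (l i)\<^sup>2) = 1 \<and> (\<forall>i<m. l i \<ge> 0)}"

text \<open>
  The inner maximum is written as a supremum: for \<open>m \<ge> 1\<close> it is that of a continuous
  function on a nonempty compact set, so it is attained. (For \<open>m = 0\<close> the set is
  empty and the value is meaningless.) The outer minimum ranges over a finite set.
\<close>

definition xi_pm1 :: "real \<Rightarrow> nat \<Rightarrow> nat \<Rightarrow> (nat \<Rightarrow> nat \<Rightarrow> real) \<Rightarrow> real" where
  "xi_pm1 \<kappa> m n A =
     Min ((\<lambda>x. SUP l\<in>nonneg_sphere m.
                 \<kappa> * (\<Sum>i<m. l i) - (\<Sum>i<m. l i * (\<Sum>j<n. A i j * x j))) ` cube_pm1 n)"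

definition erfc :: "real \<Rightarrow> real" where
  "erfc x = 2 / sqrt pi * (LBINT t:{x..}. exp (- t\<^sup>2))"

definition f_gar :: "real \<Rightarrow> real" where
  "f_gar \<kappa> = 1 / sqrt (2 * pi) * (LBINT z:{-\<kappa>..}. (z + \<kappa>)\<^sup>2 * exp (- z\<^sup>2 / 2))"

definition std_normal_matrix ::
  "'a measure \<Rightarrow> nat \<Rightarrow> nat \<Rightarrow> (nat \<Rightarrow> nat \<Rightarrow> 'a \<Rightarrow> real) \<Rightarrow> bool" where
  "std_normal_matrix M m n H \<longleftrightarrow>
     prob_space M \<and>
     prob_space.indep_vars M (\<lambda>_. borel) (\<lambda>(i, j). H i j) ({..<m} \<times> {..<n}) \<and>
     (\<forall>i<m. \<forall>j<n. distributed M lborel (H i j) std_normal_density)"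

end

theory Submission
  imports Defs "HOL-Real_Asymp.Real_Asymp"
begin

text \<open>
  This is Gordon's comparison argument. For a fixed \<open>x\<close> the maximum over \<open>\<lambda>\<close> is the norm of the positive
  part of \<open>\<kappa>1 - Hx\<close>, unless that positive part vanishes. Replace this norm by a smooth function
  \<open>G(-Hx)\<close> whose gradient has norm at most 1, and compare the Gaussian family \<open>(-Hx, g\<^sub>0)\<close> with the
  decoupled family \<open>(g, \<langle>h, x\<rangle>)\<close>, where \<open>g\<close>, \<open>h\<close>, \<open>g\<^sub>0\<close> are independent standard Gaussian. For each single \<open>x\<close>
  the two have the same law. Rotating the second family into the first, Gaussian integration by
  parts turns the derivative of \<open>E exp (- (\<Sum>x. exp (- \<beta> (G(v\<^sub>x) + s\<^sub>x - t))))\<close> into a sum over pairs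
  \<open>x \<noteq> y\<close> of nonnegative weights times \<open>(1 - \<langle>x, y\<rangle>) (1 - \<langle>\<nabla>G(v\<^sub>x), \<nabla>G(v\<^sub>y)\<rangle>) \<ge> 0\<close>. For \<open>\<beta> = n\<close> this
  double exponential is essentially the indicator of \<open>min\<^sub>x (G(v\<^sub>x) + s\<^sub>x) \<ge> t\<close> on the scale \<open>\<surd>n\<close>, and for
  the decoupled family the minimum is \<open>\<parallel>(\<kappa> + g)\<^sub>+\<parallel> - \<parallel>h\<parallel>\<^sub>1 / \<surd>n\<close>, which concentrates by Chebyshev's
  inequality.

  If the threshold \<open>\<xi>l\<close> is negative, the norm of the positive part gives no information; then the
  same result for a large constant \<open>K\<close> in place of \<open>\<kappa>\<close> provides, for every \<open>x\<close>, a row with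
  \<open>K - (Hx)\<^sub>i > 0\<close>, so that \<open>\<xi> \<ge> \<kappa> - K\<close>, which is enough because \<open>\<xi>l\<close> is of order \<open>- \<surd>n\<close>.
\<close>

subsection \<open>Gaussian integration by parts\<close>

definition gauss :: "real measure" where
  "gauss = density lborel (\<lambda>x. ennreal (std_normal_density x))"

lemma sets_gauss [simp, measurable_cong]: "sets gauss = sets borel"
  by (simp add: gauss_def)

lemma space_gauss [simp]: "space gauss = UNIV"
  by (simp add: gauss_def)

lemma prob_space_gauss: "prob_space gauss"
  unfolding gauss_def by (rule prob_space_normal_density) simp

lemma integrable_gauss_iff:
  fixes f :: "real \<Rightarrow> real"
  assumes "f \<in> borel_measurable borel"
  shows "integrable gauss f \<longleftrightarrow> integrable lborel (\<lambda>x. std_normal_density x * f x)"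
  using assms unfolding gauss_def by (subst integrable_density) auto

lemma integral_gauss:
  fixes f :: "real \<Rightarrow> real"
  assumes "f \<in> borel_measurable borel"
  shows "(\<integral>x. f x \<partial>gauss) = (\<integral>x. std_normal_density x * f x \<partial>lborel)"
  using assms unfolding gauss_def by (subst integral_density) auto

text \<open>On \<open>{- real i..real i}\<close> the fundamental theorem gives
  \<open>F (real i) - F (- real i)\<close>, which tends to 0. Dominated convergence with the
  majorant \<open>\<bar>f x\<bar>\<close> passes to the whole line.\<close>

lemma lborel_integral_derivative_eq_0:
  fixes F f :: "real \<Rightarrow> real"
  assumes F: "\<And>x. (F has_real_derivative f x) (at x)"
    and f: "integrable lborel f"
    and top: "(F \<longlongrightarrow> 0) at_top" and bot: "(F \<longlongrightarrow> 0) at_bot"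
  shows "(\<integral>x. f x \<partial>lborel) = 0"
proof -
  have [measurable]: "f \<in> borel_measurable borel"
    using borel_measurable_integrable[OF f] by simp
  define g where "g = (\<lambda>i::nat. \<lambda>x. indicator {- real i..real i} x *\<^sub>R f x)"
  have g: "integral\<^sup>L lborel (g i) = F (real i) - F (- real i)" for i
  proof -
    have si: "set_integrable lborel {- real i..real i} f"
      unfolding set_integrable_def using f by (intro integrable_mult_indicator) auto
    have "(f has_integral (F (real i) - F (- real i))) {- real i..real i}"
      by (rule fundamental_theorem_of_calculus)
        (auto intro: has_field_derivative_at_within F simp flip: has_real_derivative_iff_has_vector_derivative)
    then show ?thesis
      using set_borel_integral_eq_integral(2)[OF si]
      by (simp add: g_def set_lebesgue_integral_def integral_unique)
  qed
  have "(\<lambda>i. integral\<^sup>L lborel (g i)) \<longlonglongrightarrow> integral\<^sup>L lborel f"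
  proof (rule integral_dominated_convergence[where w="\<lambda>x. \<bar>f x\<bar>"])
    show "AE x in lborel. (\<lambda>i. g i x) \<longlonglongrightarrow> f x"
    proof (rule AE_I2)
      fix x :: real
      have "eventually (\<lambda>i. g i x = f x) sequentially"
      proof (rule eventually_sequentiallyI[of "nat \<lceil>\<bar>x\<bar>\<rceil>"])
        fix i assume "i \<ge> nat \<lceil>\<bar>x\<bar>\<rceil>"
        then have "x \<in> {- real i..real i}" by (auto simp: abs_le_iff)
        then show "g i x = f x" by (simp add: g_def)
      qed
      then show "(\<lambda>i. g i x) \<longlonglongrightarrow> f x" by (rule tendsto_eventually)
    qed
  qed (use f in \<open>auto simp: g_def split: split_indicator\<close>)
  moreover have "(\<lambda>i. integral\<^sup>L lborel (g i)) \<longlonglongrightarrow> 0 - 0"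
    unfolding g
    by (intro tendsto_diff filterlim_compose[OF top] filterlim_compose[OF bot]
        filterlim_real_sequentially filterlim_compose[OF filterlim_uminus_at_bot_at_top])
  ultimately show ?thesis using LIMSEQ_unique by fastforce
qed

lemma DERIV_std_normal_density:
  "(std_normal_density has_real_derivative (- x * std_normal_density x)) (at x)"
  unfolding std_normal_density_def
  by (auto intro!: derivative_eq_intros simp: power2_eq_square field_simps)

lemma std_normal_density_tendsto_0:
  "(std_normal_density \<longlongrightarrow> 0) at_top" "(std_normal_density \<longlongrightarrow> 0) at_bot"
proof -
  have *: "(std_normal_density \<longlongrightarrow> 0) F" if "filterlim (\<lambda>x::real. x\<^sup>2) at_top F" for F
  proof -
    have "filterlim (\<lambda>x::real. - x\<^sup>2 / 2) at_bot F"
      using filterlim_tendsto_pos_mult_at_top[OF tendsto_const[of "1/2"] _ that]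
      by (simp add: filterlim_uminus_at_bot)
    then have "((\<lambda>x::real. exp (- x\<^sup>2 / 2)) \<longlongrightarrow> 0) F"
      by (rule filterlim_compose[OF exp_at_bot])
    then have "((\<lambda>x::real. 1 / sqrt (2 * pi) * exp (- x\<^sup>2 / 2)) \<longlongrightarrow> 1 / sqrt (2 * pi) * 0) F"
      by (intro tendsto_mult tendsto_const)
    then show ?thesis by (simp add: std_normal_density_def[abs_def])
  qed
  show "(std_normal_density \<longlongrightarrow> 0) at_top" "(std_normal_density \<longlongrightarrow> 0) at_bot"
    by (rule *, rule filterlim_pow_at_top filterlim_pow_at_bot_even; simp add: filterlim_ident)+
qed

text \<open>Stein's identity. The density has derivative \<open>- x\<close> times itself, so the
  product of the density and \<open>f\<close> has the derivative density times
  \<open>f' x - x * f x\<close>. It vanishes at both ends because \<open>f\<close> is bounded, hence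
  the integral of this derivative is 0.\<close>

lemma gauss_integration_by_parts:
  fixes f f' :: "real \<Rightarrow> real"
  assumes f: "\<And>x. (f has_real_derivative f' x) (at x)"
    and [measurable]: "f' \<in> borel_measurable borel"
    and C: "\<And>x. \<bar>f x\<bar> \<le> C" "\<And>x. \<bar>f' x\<bar> \<le> C"
  shows "(\<integral>x. x * f x \<partial>gauss) = (\<integral>x. f' x \<partial>gauss)"
proof -
  have "continuous_on UNIV f"
    using f by (intro continuous_at_imp_continuous_on) (auto intro: DERIV_isCont)
  then have [measurable]: "f \<in> borel_measurable borel"
    by (rule borel_measurable_continuous_onI)
  have i1: "integrable lborel (\<lambda>x. std_normal_density x * (x * f x))"
  proof (rule Bochner_Integration.integrable_bound)
    show "integrable lborel (\<lambda>x. C * (std_normal_density x * \<bar>x\<bar>))"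
      using integrable_std_normal_moment_abs[of 1] by auto
    show "AE x in lborel. norm (std_normal_density x * (x * f x)) \<le> norm (C * (std_normal_density x * \<bar>x\<bar>))"
    proof (rule AE_I2)
      fix x
      have "\<bar>f x\<bar> \<le> \<bar>C\<bar>" using C(1)[of x] by simp
      then show "norm (std_normal_density x * (x * f x)) \<le> norm (C * (std_normal_density x * \<bar>x\<bar>))"
        using mult_mono[of "\<bar>f x\<bar>" "\<bar>C\<bar>" "\<bar>x\<bar> * std_normal_density x" "\<bar>x\<bar> * std_normal_density x"]
        by (simp add: abs_mult mult_ac)
    qed
  qed auto
  have i2: "integrable lborel (\<lambda>x. std_normal_density x * f' x)"
  proof (rule Bochner_Integration.integrable_bound)
    show "integrable lborel (\<lambda>x. C * std_normal_density x)"
      using integrable_std_normal_moment_abs[of 0] by auto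
    show "AE x in lborel. norm (std_normal_density x * f' x) \<le> norm (C * std_normal_density x)"
    proof (rule AE_I2)
      fix x
      show "norm (std_normal_density x * f' x) \<le> norm (C * std_normal_density x)"
        using C(2)[of x] by (auto simp: abs_mult mult.commute intro!: mult_right_mono)
    qed
  qed auto
  have lim: "((\<lambda>x. std_normal_density x * f x) \<longlongrightarrow> 0) F" if "(std_normal_density \<longlongrightarrow> 0) F" for F
  proof (rule Lim_null_comparison[where g="\<lambda>x. std_normal_density x * C"])
    show "\<forall>\<^sub>F x in F. norm (std_normal_density x * f x) \<le> std_normal_density x * C"
      using C(1) by (auto simp: abs_mult intro!: always_eventually mult_left_mono)
    show "((\<lambda>x. std_normal_density x * C) \<longlongrightarrow> 0) F"
      using that by (rule tendsto_mult_left_zero)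
  qed
  have "(\<integral>x. std_normal_density x * f' x - std_normal_density x * (x * f x) \<partial>lborel) = 0"
  proof (rule lborel_integral_derivative_eq_0[where F="\<lambda>x. std_normal_density x * f x"])
    show "((\<lambda>x. std_normal_density x * f x) has_real_derivative
        std_normal_density x * f' x - std_normal_density x * (x * f x)) (at x)" for x
      by (auto intro!: derivative_eq_intros DERIV_std_normal_density f)
  qed (use i1 i2 in \<open>auto intro!: lim std_normal_density_tendsto_0\<close>)
  then show ?thesis using i1 i2 by (simp add: integral_gauss)
qed

section \<open>Products of standard Gaussian measures\<close>

abbreviation gauss_PiM :: "'k set \<Rightarrow> ('k \<Rightarrow> real) measure" where
  "gauss_PiM I \<equiv> Pi\<^sub>M I (\<lambda>_. gauss)"

interpretation gauss: prob_space gauss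
  by (rule prob_space_gauss)

interpretation gauss_PiM: product_prob_space "\<lambda>_. gauss" I for I
  by (rule product_prob_spaceI) (rule prob_space_gauss)

lemma prob_space_integrable_bounded:
  fixes f :: "'a \<Rightarrow> real"
  assumes "prob_space M" "f \<in> borel_measurable M" "\<And>x. \<bar>f x\<bar> \<le> C"
  shows "integrable M f"
  using assms by (intro finite_measure.integrable_const_bound[where B=C]) (auto simp: prob_space_def)

lemma integrable_gauss_abs: "integrable gauss (\<lambda>x. \<bar>x\<bar>)"
  using integrable_std_normal_moment_abs[of 1] by (subst integrable_gauss_iff) auto

lemma distr_gauss_PiM_component:
  "k \<in> I \<Longrightarrow> distr (gauss_PiM I) gauss (\<lambda>w. w k) = gauss"
  by (rule gauss_PiM.PiM_component)

lemma integral_gauss_PiM_component: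
  fixes f :: "real \<Rightarrow> real"
  assumes "k \<in> I" and [measurable]: "f \<in> borel_measurable borel"
  shows "(\<integral>w. f (w k) \<partial>gauss_PiM I) = (\<integral>x. f x \<partial>gauss)"
proof -
  have [measurable]: "(\<lambda>w. w k) \<in> measurable (gauss_PiM I) gauss"
    using assms(1) by (rule measurable_component_singleton)
  show ?thesis
    by (subst (2) distr_gauss_PiM_component[OF assms(1), symmetric]) (simp add: integral_distr)
qed

lemma integrable_gauss_PiM_component:
  fixes f :: "real \<Rightarrow> real"
  assumes "k \<in> I" and f: "integrable gauss f"
  shows "integrable (gauss_PiM I) (\<lambda>w. f (w k))"
proof -
  have [measurable]: "(\<lambda>w. w k) \<in> measurable (gauss_PiM I) gauss"
    using assms(1) by (rule measurable_component_singleton)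
  have "integrable (distr (gauss_PiM I) gauss (\<lambda>w. w k)) f"
    using f by (simp add: distr_gauss_PiM_component[OF assms(1)])
  then show ?thesis by (rule integrable_distr[rotated]) simp
qed

lemma integrable_component_mult_bounded:
  assumes "k \<in> I" and [measurable]: "F \<in> borel_measurable (gauss_PiM I)"
    and C: "\<And>w. \<bar>F w\<bar> \<le> C"
  shows "integrable (gauss_PiM I) (\<lambda>w. w k * F w)"
proof (rule Bochner_Integration.integrable_bound)
  show "integrable (gauss_PiM I) (\<lambda>w. C * \<bar>w k\<bar>)"
    using integrable_gauss_PiM_component[OF assms(1) integrable_gauss_abs] by auto
  have [measurable]: "(\<lambda>w. w k) \<in> borel_measurable (gauss_PiM I)"
    using measurable_component_singleton[OF assms(1), of "\<lambda>_. gauss"] by (simp cong: measurable_cong_sets)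
  show "(\<lambda>w. w k * F w) \<in> borel_measurable (gauss_PiM I)" by measurable
  show "AE w in gauss_PiM I. norm (w k * F w) \<le> norm (C * \<bar>w k\<bar>)"
  proof (rule AE_I2)
    fix w
    have "\<bar>w k\<bar> * \<bar>F w\<bar> \<le> \<bar>w k\<bar> * \<bar>C\<bar>" using C[of w] by (intro mult_left_mono) auto
    then show "norm (w k * F w) \<le> norm (C * \<bar>w k\<bar>)" by (simp add: abs_mult mult.commute)
  qed
qed

text \<open>Fubini isolates the coordinate \<open>k\<close>, and the one-dimensional identity
  applies to each slice \<open>w(k := r)\<close>. The bounds on \<open>F\<close> and
  \<open>F'\<close> supply integrability.\<close>

lemma gauss_PiM_integration_by_parts:
  assumes I: "finite I" "k \<in> I"
    and F: "\<And>w r. ((\<lambda>r. F (w(k := r))) has_real_derivative F' (w(k := r))) (at r)"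
    and [measurable]: "F \<in> borel_measurable (gauss_PiM I)" "F' \<in> borel_measurable (gauss_PiM I)"
    and C: "\<And>w. \<bar>F w\<bar> \<le> C" "\<And>w. \<bar>F' w\<bar> \<le> C"
  shows "(\<integral>w. w k * F w \<partial>gauss_PiM I) = (\<integral>w. F' w \<partial>gauss_PiM I)"
proof -
  define J where "J = I - {k}"
  have J: "I = insert k J" "finite J" "k \<notin> J" using I by (auto simp: J_def)
  have prob: "prob_space (gauss_PiM I)" by (rule gauss_PiM.P.prob_space_axioms)
  have 1: "integrable (gauss_PiM (insert k J)) (\<lambda>w. w k * F w)"
    using integrable_component_mult_bounded[OF I(2) assms(4) C(1)] unfolding J(1) .
  have 2: "integrable (gauss_PiM (insert k J)) F'"
    using prob_space_integrable_bounded[OF prob assms(5) C(2)] unfolding J(1) .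
  have "(\<integral>w. w k * F w \<partial>gauss_PiM I) = (\<integral>w. (\<integral>y. y * F (w(k:=y)) \<partial>gauss) \<partial>gauss_PiM J)"
    unfolding J(1) by (subst gauss_PiM.product_integral_insert[OF J(2,3) 1]) simp
  also have "\<dots> = (\<integral>w. (\<integral>y. F' (w(k:=y)) \<partial>gauss) \<partial>gauss_PiM J)"
  proof (rule Bochner_Integration.integral_cong[OF refl])
    fix w assume w: "w \<in> space (gauss_PiM J)"
    have "(\<lambda>y. w(k := y)) \<in> measurable gauss (gauss_PiM I)"
      unfolding J(1) using measurable_component_update[OF w J(3)] .
    then have "(\<lambda>y. F' (w(k := y))) \<in> borel_measurable gauss" by measurable
    then show "(\<integral>y. y * F (w(k:=y)) \<partial>gauss) = (\<integral>y. F' (w(k:=y)) \<partial>gauss)"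
      using F C by (intro gauss_integration_by_parts[where C=C]) auto
  qed
  also have "\<dots> = (\<integral>w. F' w \<partial>gauss_PiM I)"
    unfolding J(1) by (subst gauss_PiM.product_integral_insert[OF J(2,3) 2]) simp
  finally show ?thesis .
qed

subsection \<open>Gaussian interpolation\<close>

lemma gauss_PiM_component_measurable [measurable (raw)]:
  "k \<in> I \<Longrightarrow> (\<lambda>w. w k) \<in> borel_measurable (gauss_PiM I)"
  using measurable_component_singleton[of k I "\<lambda>_. gauss"] by (simp cong: measurable_cong_sets)

text \<open>The families \<open>A\<close> and \<open>B\<close> are functions of one Gaussian vector,
  and \<open>AB\<close> makes them independent. Along the rotation from \<open>A\<close> to
  \<open>B\<close>, integration by parts turns the derivative of the expectation into
  \<open>sin \<theta> * cos \<theta>\<close> times the mean of the sum in \<open>pos\<close>. The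
  chain rule is assumed along curves because two kinds of curve occur: the rotation in
  \<open>\<theta>\<close> and the variation of a single Gaussian coordinate.\<close>

lemma gaussian_comparison:
  fixes A B :: "'s \<Rightarrow> 'k \<Rightarrow> real" and \<Phi> :: "('s \<Rightarrow> real) \<Rightarrow> real"
  assumes I: "finite I" and S: "finite S"
    and deriv: "\<And>\<gamma> \<gamma>' t. (\<And>s. s \<in> S \<Longrightarrow> (\<gamma> s has_real_derivative \<gamma>' s) (at t)) \<Longrightarrow>
      ((\<lambda>t. \<Phi> (\<lambda>s. \<gamma> s t)) has_real_derivative (\<Sum>s\<in>S. \<Phi>' s (\<lambda>s. \<gamma> s t) * \<gamma>' s)) (at t)"
    and deriv1: "\<And>\<gamma> \<gamma>' t u. u \<in> S \<Longrightarrow> (\<And>s. s \<in> S \<Longrightarrow> (\<gamma> s has_real_derivative \<gamma>' s) (at t)) \<Longrightarrow>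
      ((\<lambda>t. \<Phi>' u (\<lambda>s. \<gamma> s t)) has_real_derivative (\<Sum>s\<in>S. \<Phi>'' u s (\<lambda>s. \<gamma> s t) * \<gamma>' s)) (at t)"
    and [measurable]: "\<Phi> \<in> borel_measurable (Pi\<^sub>M UNIV (\<lambda>_. borel))"
      "\<And>s. \<Phi>' s \<in> borel_measurable (Pi\<^sub>M UNIV (\<lambda>_. borel))"
      "\<And>s u. \<Phi>'' s u \<in> borel_measurable (Pi\<^sub>M UNIV (\<lambda>_. borel))"
    and bound: "\<And>z. \<bar>\<Phi> z\<bar> \<le> C" "\<And>s z. s \<in> S \<Longrightarrow> \<bar>\<Phi>' s z\<bar> \<le> C" "\<And>s u z. s \<in> S \<Longrightarrow> u \<in> S \<Longrightarrow> \<bar>\<Phi>'' s u z\<bar> \<le> C"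
    and AB: "\<And>s u. s \<in> S \<Longrightarrow> u \<in> S \<Longrightarrow> (\<Sum>k\<in>I. A s k * B u k) = 0"
    and pos: "\<And>z. 0 \<le> (\<Sum>s\<in>S. \<Sum>u\<in>S. ((\<Sum>k\<in>I. B s k * B u k) - (\<Sum>k\<in>I. A s k * A u k)) * \<Phi>'' s u z)"
  shows "(\<integral>w. \<Phi> (\<lambda>s. \<Sum>k\<in>I. A s k * w k) \<partial>gauss_PiM I) \<le> (\<integral>w. \<Phi> (\<lambda>s. \<Sum>k\<in>I. B s k * w k) \<partial>gauss_PiM I)"
proof -
  have C: "0 \<le> C" using bound(1)[of undefined] by linarith
  \<comment> \<open>The coefficients of the rotated family run from \<open>A\<close> at angle 0 to
    \<open>B\<close> at \<open>pi/2\<close>. \<open>b\<close> is the derivative of \<open>a\<close>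
    in the angle, so \<open>W\<close> is the velocity of \<open>Z\<close>.\<close>
  define a where "a \<theta> s k = cos \<theta> * A s k + sin \<theta> * B s k" for \<theta> s k
  define b where "b \<theta> s k = cos \<theta> * B s k - sin \<theta> * A s k" for \<theta> s k
  define Z where "Z \<theta> w s = (\<Sum>k\<in>I. a \<theta> s k * w k)" for \<theta> w s
  define W where "W \<theta> w s = (\<Sum>k\<in>I. b \<theta> s k * w k)" for \<theta> w s
  define D where "D \<theta> w = (\<Sum>s\<in>S. \<Phi>' s (Z \<theta> w) * W \<theta> w s)" for \<theta> w
  define P where "P = gauss_PiM I"
  interpret P: prob_space P unfolding P_def by (rule gauss_PiM.P.prob_space_axioms)
  have [measurable]: "k \<in> I \<Longrightarrow> (\<lambda>w. w k) \<in> borel_measurable P" for k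
    unfolding P_def by (rule gauss_PiM_component_measurable)
  have dZ: "((\<lambda>\<theta>. Z \<theta> w s) has_real_derivative W \<theta> w s) (at \<theta>)" for w s \<theta>
    unfolding Z_def W_def a_def b_def by (auto intro!: derivative_eq_intros sum.cong simp: algebra_simps)
  have dPhi: "((\<lambda>\<theta>. \<Phi> (Z \<theta> w)) has_real_derivative D \<theta> w) (at \<theta>)" for w \<theta>
    unfolding D_def using deriv[of "\<lambda>s \<theta>. Z \<theta> w s" "W \<theta> w" \<theta>] dZ by simp
  have contD: "isCont (\<lambda>\<theta>. D \<theta> w) \<theta>" for w \<theta>
    unfolding D_def
  proof (intro continuous_intros)
    fix s assume s: "s \<in> S"
    show "isCont (\<lambda>\<theta>. \<Phi>' s (Z \<theta> w)) \<theta>"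
      using deriv1[OF s, of "\<lambda>s \<theta>. Z \<theta> w s" "W \<theta> w" \<theta>] dZ by (auto intro: DERIV_isCont)
    show "isCont (\<lambda>\<theta>. W \<theta> w s) \<theta>"
      unfolding W_def b_def by (intro continuous_intros)
  qed
  have ftc: "(\<integral>\<theta>. D \<theta> w * indicator {0..pi/2} \<theta> \<partial>lborel) = \<Phi> (Z (pi/2) w) - \<Phi> (Z 0 w)" for w
    by (rule integral_FTC_Icc_real) (auto intro: dPhi contD)
  have Z_meas: "(\<lambda>x. Z (fst x) (snd x)) \<in> measurable (lborel \<Otimes>\<^sub>M P) (Pi\<^sub>M UNIV (\<lambda>_. borel))"
    unfolding Z_def a_def by (rule measurable_PiM_single') (auto simp: P_def)
  have Z_meas': "Z \<theta> \<in> measurable P (Pi\<^sub>M UNIV (\<lambda>_. borel))" for \<theta>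
    unfolding Z_def[abs_def] a_def by (rule measurable_PiM_single') (auto simp: P_def)
  have W_meas [measurable]: "(\<lambda>x. W (fst x) (snd x) s) \<in> borel_measurable (lborel \<Otimes>\<^sub>M P)" for s
    unfolding W_def b_def by measurable
  have D_meas [measurable]: "(\<lambda>x. D (fst x) (snd x)) \<in> borel_measurable (lborel \<Otimes>\<^sub>M P)"
    unfolding D_def
    by (intro borel_measurable_sum borel_measurable_times measurable_compose[OF Z_meas] W_meas assms)
  \<comment> \<open>An integrable majorant of \<open>D\<close> that does not depend on the angle. It
    justifies exchanging the integrals over \<open>\<theta>\<close> and \<open>w\<close>.\<close>
  define K where "K w = (\<Sum>s\<in>S. C * (\<Sum>k\<in>I. (\<bar>A s k\<bar> + \<bar>B s k\<bar>) * \<bar>w k\<bar>))" for w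
  have K0: "0 \<le> K w" for w
    unfolding K_def using C by (intro sum_nonneg mult_nonneg_nonneg) auto
  have DK: "\<bar>D \<theta> w\<bar> \<le> K w" for \<theta> w
    unfolding D_def K_def
  proof (rule order.trans[OF sum_abs], rule sum_mono)
    fix s assume s: "s \<in> S"
    have "\<bar>b \<theta> s k\<bar> \<le> \<bar>A s k\<bar> + \<bar>B s k\<bar>" for k
    proof -
      have "\<bar>b \<theta> s k\<bar> \<le> \<bar>cos \<theta>\<bar> * \<bar>B s k\<bar> + \<bar>sin \<theta>\<bar> * \<bar>A s k\<bar>"
        unfolding b_def by (simp add: abs_mult[symmetric] abs_triangle_ineq4)
      also have "\<dots> \<le> 1 * \<bar>B s k\<bar> + 1 * \<bar>A s k\<bar>"
        by (intro add_mono mult_right_mono) auto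
      finally show ?thesis by simp
    qed
    then have "\<bar>W \<theta> w s\<bar> \<le> (\<Sum>k\<in>I. (\<bar>A s k\<bar> + \<bar>B s k\<bar>) * \<bar>w k\<bar>)"
      unfolding W_def by (intro order.trans[OF sum_abs] sum_mono) (auto simp: abs_mult intro!: mult_right_mono)
    then show "\<bar>\<Phi>' s (Z \<theta> w) * W \<theta> w s\<bar> \<le> C * (\<Sum>k\<in>I. (\<bar>A s k\<bar> + \<bar>B s k\<bar>) * \<bar>w k\<bar>)"
      unfolding abs_mult using bound(2)[OF s] C by (intro mult_mono) auto
  qed
  have K_int: "integrable P K"
    unfolding K_def P_def
    by (intro Bochner_Integration.integrable_sum integrable_mult_right integrable_gauss_PiM_component integrable_gauss_abs)
  interpret LP: pair_sigma_finite lborel P ..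
  have int_KI: "integrable (lborel \<Otimes>\<^sub>M P) (\<lambda>(\<theta>, w). K w * indicator {0..pi/2} \<theta>)"
  proof (rule LP.Fubini_integrable)
    have [measurable]: "K \<in> borel_measurable P" using K_int by simp
    show "(\<lambda>(\<theta>, w). K w * indicator {0..pi/2} \<theta>) \<in> borel_measurable (lborel \<Otimes>\<^sub>M P)"
      by measurable
    have "(\<lambda>\<theta>. \<integral>w. norm (K w * indicator {0..pi/2} \<theta>) \<partial>P) = (\<lambda>\<theta>. (\<integral>w. K w \<partial>P) * indicator {0..pi/2::real} \<theta>)"
      using K0 by (simp add: abs_mult)
    moreover have "integrable lborel (\<lambda>\<theta>. (\<integral>w. K w \<partial>P) * indicator {0..pi/2::real} \<theta>)"
      by (intro integrable_mult_right integrable_real_indicator) auto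
    ultimately show "integrable lborel (\<lambda>\<theta>. \<integral>w. norm (case (\<theta>, w) of (\<theta>, w) \<Rightarrow> K w * indicator {0..pi/2} \<theta>) \<partial>P)"
      by simp
    show "AE \<theta> in lborel. integrable P (\<lambda>w. case (\<theta>, w) of (\<theta>, w) \<Rightarrow> K w * indicator {0..pi/2} \<theta>)"
      using K_int by simp
  qed
  have int_D: "integrable (lborel \<Otimes>\<^sub>M P) (\<lambda>(\<theta>, w). D \<theta> w * indicator {0..pi/2} \<theta>)"
  proof (rule Bochner_Integration.integrable_bound[OF int_KI])
    show "(\<lambda>(\<theta>, w). D \<theta> w * indicator {0..pi/2} \<theta>) \<in> borel_measurable (lborel \<Otimes>\<^sub>M P)"
      unfolding split_beta' by measurable
    show "AE x in lborel \<Otimes>\<^sub>M P. norm (case x of (\<theta>, w) \<Rightarrow> D \<theta> w * indicator {0..pi/2} \<theta>)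
        \<le> norm (case x of (\<theta>, w) \<Rightarrow> K w * indicator {0..pi/2} \<theta>)"
      using DK K0 by (auto simp: abs_mult split: split_indicator intro!: AE_I2)
  qed
  \<comment> \<open>The expected derivative is nonnegative. Each \<open>w k\<close> inside the
    velocity is removed by integration by parts, which leaves second derivatives weighted by
    covariances of velocity and position.\<close>
  have ED: "0 \<le> (\<integral>w. D \<theta> w \<partial>P)" if \<theta>: "\<theta> \<in> {0..pi/2}" for \<theta>
  proof -
    define h where "h s w = \<Phi>' s (Z \<theta> w)" for s w
    define h' where "h' s k w = (\<Sum>u\<in>S. \<Phi>'' s u (Z \<theta> w) * a \<theta> u k)" for s k w
    have [measurable]: "h s \<in> borel_measurable P" "h' s k \<in> borel_measurable P" for s k
      unfolding h_def h'_def
      by (intro borel_measurable_sum borel_measurable_times borel_measurable_const measurable_compose[OF Z_meas'] assms)+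
    have ibp: "(\<integral>w. w k * h s w \<partial>P) = (\<integral>w. h' s k w \<partial>P)" if "s \<in> S" "k \<in> I" for s k
      unfolding P_def
    proof (rule gauss_PiM_integration_by_parts[OF I \<open>k \<in> I\<close>])
      fix w r
      have Zk: "((\<lambda>r. Z \<theta> (w(k := r)) u) has_real_derivative a \<theta> u k) (at r)" for u
      proof -
        have "Z \<theta> (w(k := r)) u = a \<theta> u k * r + (\<Sum>j\<in>I - {k}. a \<theta> u j * w j)" for r
          unfolding Z_def using I \<open>k \<in> I\<close> by (simp add: sum.remove)
        then show ?thesis by (auto intro!: derivative_eq_intros)
      qed
      show "((\<lambda>r. h s (w(k := r))) has_real_derivative h' s k (w(k := r))) (at r)"
        unfolding h_def h'_def
        using deriv1[OF \<open>s \<in> S\<close>, of "\<lambda>u r. Z \<theta> (w(k := r)) u" "\<lambda>u. a \<theta> u k" r] Zk by simp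
    next
      fix w
      show "\<bar>h s w\<bar> \<le> C + (\<Sum>u\<in>S. C * \<bar>a \<theta> u k\<bar>)"
        unfolding h_def using bound(2)[OF \<open>s \<in> S\<close>, of "Z \<theta> w"] C
        by (smt (verit) sum_nonneg mult_nonneg_nonneg abs_ge_zero)
      have "\<bar>h' s k w\<bar> \<le> (\<Sum>u\<in>S. C * \<bar>a \<theta> u k\<bar>)"
        unfolding h'_def
        by (rule order.trans[OF sum_abs], rule sum_mono)
          (auto simp: abs_mult intro!: mult_right_mono bound \<open>s \<in> S\<close>)
      then show "\<bar>h' s k w\<bar> \<le> C + (\<Sum>u\<in>S. C * \<bar>a \<theta> u k\<bar>)" using C by simp
    qed (simp_all flip: P_def)
    have int1: "integrable P (\<lambda>w. w k * h s w)" if "s \<in> S" "k \<in> I" for s k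
      unfolding P_def
      by (rule integrable_component_mult_bounded[OF \<open>k \<in> I\<close>, where C=C])
        (auto simp: h_def bound that simp flip: P_def intro!: measurable_compose[OF Z_meas'])
    have int2: "integrable P (\<lambda>w. \<Phi>'' s u (Z \<theta> w))" if "s \<in> S" "u \<in> S" for s u
      by (rule prob_space_integrable_bounded[where C=C])
        (auto simp: bound that P.prob_space_axioms intro!: measurable_compose[OF Z_meas'])
    \<comment> \<open>Covariance of the velocity at \<open>s\<close> with the position at
      \<open>u\<close>. The two mixed terms vanish by \<open>AB\<close>; the other two carry the
      same factor \<open>sin \<theta> * cos \<theta>\<close>, which is nonnegative on the first
      quadrant.\<close>
    have cov: "(\<Sum>k\<in>I. b \<theta> s k * a \<theta> u k) = sin \<theta> * cos \<theta> * ((\<Sum>k\<in>I. B s k * B u k) - (\<Sum>k\<in>I. A s k * A u k))"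
      if "s \<in> S" "u \<in> S" for s u
    proof -
      have "(\<Sum>k\<in>I. b \<theta> s k * a \<theta> u k) = (\<Sum>k\<in>I. sin \<theta> * cos \<theta> * (B s k * B u k) - sin \<theta> * cos \<theta> * (A s k * A u k)
          + (cos \<theta>)\<^sup>2 * (A u k * B s k) - (sin \<theta>)\<^sup>2 * (A s k * B u k))"
        by (rule sum.cong) (auto simp: a_def b_def algebra_simps power2_eq_square)
      also have "\<dots> = sin \<theta> * cos \<theta> * (\<Sum>k\<in>I. B s k * B u k) - sin \<theta> * cos \<theta> * (\<Sum>k\<in>I. A s k * A u k)
          + (cos \<theta>)\<^sup>2 * (\<Sum>k\<in>I. A u k * B s k) - (sin \<theta>)\<^sup>2 * (\<Sum>k\<in>I. A s k * B u k)"
        by (simp only: sum.distrib sum_subtractf sum_distrib_left)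
      finally show ?thesis using AB that by (simp add: algebra_simps)
    qed
    have "(\<integral>w. D \<theta> w \<partial>P) = (\<integral>w. (\<Sum>s\<in>S. \<Sum>k\<in>I. b \<theta> s k * (w k * h s w)) \<partial>P)"
      unfolding D_def W_def h_def by (simp add: sum_distrib_left mult_ac)
    also have "\<dots> = (\<Sum>s\<in>S. \<Sum>k\<in>I. b \<theta> s k * (\<integral>w. w k * h s w \<partial>P))"
      using int1 by (simp add: Bochner_Integration.integral_sum)
    also have "\<dots> = (\<Sum>s\<in>S. \<Sum>k\<in>I. b \<theta> s k * (\<integral>w. h' s k w \<partial>P))"
      using ibp by simp
    also have "\<dots> = (\<integral>w. (\<Sum>s\<in>S. \<Sum>k\<in>I. b \<theta> s k * h' s k w) \<partial>P)"
      using int2 by (simp add: Bochner_Integration.integral_sum h'_def)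
    also have "\<dots> = (\<integral>w. (\<Sum>s\<in>S. \<Sum>u\<in>S. (\<Sum>k\<in>I. b \<theta> s k * a \<theta> u k) * \<Phi>'' s u (Z \<theta> w)) \<partial>P)"
    proof (intro Bochner_Integration.integral_cong[OF refl] sum.cong[OF refl])
      fix w s
      show "(\<Sum>k\<in>I. b \<theta> s k * h' s k w) = (\<Sum>u\<in>S. (\<Sum>k\<in>I. b \<theta> s k * a \<theta> u k) * \<Phi>'' s u (Z \<theta> w))"
        unfolding h'_def sum_distrib_left sum_distrib_right
        by (subst sum.swap) (auto intro!: sum.cong)
    qed
    also have "\<dots> = (\<integral>w. sin \<theta> * cos \<theta> * (\<Sum>s\<in>S. \<Sum>u\<in>S. ((\<Sum>k\<in>I. B s k * B u k) - (\<Sum>k\<in>I. A s k * A u k)) * \<Phi>'' s u (Z \<theta> w)) \<partial>P)"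
      unfolding sum_distrib_left
      by (intro Bochner_Integration.integral_cong[OF refl] sum.cong[OF refl]) (simp add: cov mult.assoc)
    also have "\<dots> \<ge> 0"
      using \<theta> by (intro Bochner_Integration.integral_nonneg mult_nonneg_nonneg pos sin_ge_zero cos_ge_zero) auto
    finally show ?thesis .
  qed
  have Phi_int: "integrable P (\<lambda>w. \<Phi> (Z \<theta> w))" for \<theta>
    by (rule prob_space_integrable_bounded[where C=C])
      (auto simp: bound P.prob_space_axioms intro!: measurable_compose[OF Z_meas'])
  have "0 \<le> (\<integral>\<theta>. (\<integral>w. D \<theta> w * indicator {0..pi/2} \<theta> \<partial>P) \<partial>lborel)"
  proof (rule Bochner_Integration.integral_nonneg)
    show "0 \<le> (\<integral>w. D \<theta> w * indicator {0..pi/2} \<theta> \<partial>P)" for \<theta>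
      using ED[of \<theta>] by (cases "\<theta> \<in> {0..pi/2}") auto
  qed
  also have "\<dots> = (\<integral>w. (\<integral>\<theta>. D \<theta> w * indicator {0..pi/2} \<theta> \<partial>lborel) \<partial>P)"
    using LP.Fubini_integral[OF int_D] by simp
  also have "\<dots> = (\<integral>w. \<Phi> (Z (pi/2) w) \<partial>P) - (\<integral>w. \<Phi> (Z 0 w) \<partial>P)"
    unfolding ftc using Phi_int by simp
  finally show ?thesis by (simp add: Z_def[abs_def] a_def P_def)
qed

subsection \<open>A smooth margin function\<close>

lemma sum_Times: "(\<Sum>s\<in>X \<times> Y. f s) = (\<Sum>x\<in>X. \<Sum>y\<in>Y. f (x, y))"
  by (simp add: sum.cartesian_product)

text \<open>
  In the locale below, \<open>q\<close> smooths the positive part (with derivatives \<open>q1\<close>, \<open>q2\<close>). A block \<open>z\<close> holds the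
  \<open>m\<close> coordinates of \<open>v\<close> followed by the scalar \<open>s = z m\<close>; \<open>a1 i\<close> and \<open>a2 i j\<close> are the first and second
  partial derivatives of \<open>a z = G v + s\<close>.
\<close>

locale smoothing =
  fixes \<kappa> \<eta> \<beta> t :: real and m :: nat
  assumes eta_pos: "0 < \<eta>" and beta_pos: "0 < \<beta>"
begin

definition q :: "real \<Rightarrow> real" where "q w = (w + sqrt (w\<^sup>2 + \<eta>\<^sup>2)) / 2"
definition q1 :: "real \<Rightarrow> real" where "q1 w = (1 + w / sqrt (w\<^sup>2 + \<eta>\<^sup>2)) / 2"
definition q2 :: "real \<Rightarrow> real" where "q2 w = \<eta>\<^sup>2 / (2 * sqrt (w\<^sup>2 + \<eta>\<^sup>2) ^ 3)"

text \<open>The summand 1 keeps the root away from 0, so that \<open>G\<close> is smooth everywhere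
  and division by \<open>G\<close> creates no large factors. It costs at most 1, which is negligible
  on the scale of the square root of \<open>n\<close>.\<close>

definition G :: "(nat \<Rightarrow> real) \<Rightarrow> real" where
  "G z = sqrt (1 + (\<Sum>i<m. (q (\<kappa> + z i))\<^sup>2))"
definition a :: "(nat \<Rightarrow> real) \<Rightarrow> real" where "a z = G z + z m"
text \<open>\<open>u\<close> is half the derivative of the square of \<open>q\<close>, and
  \<open>u1\<close> is the derivative of \<open>u\<close>.\<close>

definition u :: "(nat \<Rightarrow> real) \<Rightarrow> nat \<Rightarrow> real" where "u z i = q (\<kappa> + z i) * q1 (\<kappa> + z i)"
definition u1 :: "(nat \<Rightarrow> real) \<Rightarrow> nat \<Rightarrow> real" where
  "u1 z i = (q1 (\<kappa> + z i))\<^sup>2 + q (\<kappa> + z i) * q2 (\<kappa> + z i)"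
definition a1 :: "nat \<Rightarrow> (nat \<Rightarrow> real) \<Rightarrow> real" where
  "a1 i z = (if i < m then u z i / G z else 1)"
definition a2 :: "nat \<Rightarrow> nat \<Rightarrow> (nat \<Rightarrow> real) \<Rightarrow> real" where
  "a2 i j z = (if i < m \<and> j < m then (if i = j then u1 z i / G z else 0) - u z i * u z j / G z ^ 3 else 0)"

lemma s_pos: "0 < sqrt (w\<^sup>2 + \<eta>\<^sup>2)"
  using eta_pos by (simp add: add_nonneg_pos)

lemma s_sq: "sqrt (w\<^sup>2 + \<eta>\<^sup>2) * sqrt (w\<^sup>2 + \<eta>\<^sup>2) = w\<^sup>2 + \<eta>\<^sup>2"
  by simp

lemma abs_le_s: "\<bar>w\<bar> \<le> sqrt (w\<^sup>2 + \<eta>\<^sup>2)"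
  by (rule real_le_rsqrt) simp

lemma q_ge: "max 0 w \<le> q w"
  using abs_le_s[of w] by (simp add: q_def abs_le_iff) (simp add: max_def)

lemma q_nonneg: "0 \<le> q w"
  using q_ge[of w] by simp

lemma q_le: "q w \<le> max 0 w + \<eta> / 2"
proof -
  have "sqrt (w\<^sup>2 + \<eta>\<^sup>2) \<le> \<bar>w\<bar> + \<eta>"
    using eta_pos by (intro real_le_lsqrt) (auto simp: power2_sum)
  then show ?thesis by (auto simp: q_def max_def)
qed

lemma q1_bounds: "0 \<le> q1 w" "q1 w \<le> 1"
proof -
  have "\<bar>w / sqrt (w\<^sup>2 + \<eta>\<^sup>2)\<bar> \<le> 1"
    using abs_le_s[of w] s_pos[of w] by (simp add: abs_divide)
  then show "0 \<le> q1 w" "q1 w \<le> 1" unfolding q1_def abs_le_iff by (auto simp: field_simps)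
qed

lemma q2_nonneg: "0 \<le> q2 w"
  unfolding q2_def using s_pos[of w] by (intro divide_nonneg_nonneg) (auto intro: zero_le_power)

text \<open>\<open>q\<close> is unbounded, but it is at most the root \<open>s\<close> of
  \<open>w\<^sup>2 + \<eta>\<^sup>2\<close>, while \<open>q2\<close> decays like the inverse cube of
  \<open>s\<close>. This keeps \<open>u1\<close>, and with it \<open>a2\<close>, uniformly
  bounded.\<close>

lemma q_q2_le: "q w * q2 w \<le> 1"
proof -
  let ?s = "sqrt (w\<^sup>2 + \<eta>\<^sup>2)"
  have "q w \<le> ?s" using abs_le_s[of w] by (auto simp: q_def)
  then have "q w * q2 w \<le> ?s * q2 w" using q2_nonneg by (rule mult_right_mono)
  also have "\<dots> = \<eta>\<^sup>2 / (2 * ?s\<^sup>2)"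
    using s_pos[of w] by (simp add: q2_def power2_eq_square power3_eq_cube del: real_sqrt_mult_self)
  also have "\<dots> \<le> 1"
  proof -
    have "?s\<^sup>2 = w\<^sup>2 + \<eta>\<^sup>2" by simp
    then show ?thesis using eta_pos by (simp add: divide_le_eq add_nonneg_pos del: real_sqrt_pow2_iff)
  qed
  finally show ?thesis .
qed

lemma DERIV_q: "(q has_real_derivative q1 w) (at w)"
  unfolding q_def[abs_def] q1_def using s_pos[of w]
  by (auto intro!: derivative_eq_intros simp: field_simps)

lemma DERIV_q1: "(q1 has_real_derivative q2 w) (at w)"
proof -
  let ?s = "sqrt (w\<^sup>2 + \<eta>\<^sup>2)"
  have s: "?s \<noteq> 0" "0 < w\<^sup>2 + \<eta>\<^sup>2" using s_pos[of w] by auto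
  have "((\<lambda>w. sqrt (w\<^sup>2 + \<eta>\<^sup>2)) has_real_derivative w / ?s) (at w)"
    using s by (auto intro!: derivative_eq_intros simp: field_simps)
  then have "(q1 has_real_derivative (0 + (1 * ?s - w * (w / ?s)) / (?s * ?s)) / 2) (at w)"
    unfolding q1_def[abs_def] using s
    by (intro DERIV_cdivide DERIV_add DERIV_const DERIV_divide DERIV_ident) auto
  moreover have "(0 + (1 * ?s - w * (w / ?s)) / (?s * ?s)) / 2 = q2 w"
  proof -
    have "?s - w * (w / ?s) = \<eta>\<^sup>2 / ?s"
      using s s_sq[of w] by (simp add: field_simps power2_eq_square)
    then show ?thesis using s by (simp add: q2_def power3_eq_cube del: real_sqrt_mult_self)
  qed
  ultimately show ?thesis by simp
qed

lemma DERIV_q_shift: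
  assumes "(f has_real_derivative f') (at r)"
  shows "((\<lambda>r. q (\<kappa> + f r)) has_real_derivative q1 (\<kappa> + f r) * f') (at r)"
    "((\<lambda>r. q1 (\<kappa> + f r)) has_real_derivative q2 (\<kappa> + f r) * f') (at r)"
  using assms
  by (auto intro!: DERIV_chain2[OF DERIV_q] DERIV_chain2[OF DERIV_q1] derivative_eq_intros)

lemma G_ge_1: "1 \<le> G z"
  unfolding G_def by (simp add: sum_nonneg)

lemma G_sq: "(G z)\<^sup>2 = 1 + (\<Sum>i<m. (q (\<kappa> + z i))\<^sup>2)"
  unfolding G_def by (simp add: sum_nonneg add_nonneg_nonneg)

lemma u_nonneg: "0 \<le> u z i"
  unfolding u_def using q_nonneg q1_bounds by (simp add: mult_nonneg_nonneg)

lemma sum_u_sq: "(\<Sum>i<m. (u z i)\<^sup>2) \<le> (G z)\<^sup>2"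
proof -
  have "(u z i)\<^sup>2 \<le> (q (\<kappa> + z i))\<^sup>2" for i
    unfolding u_def using q_nonneg[of "\<kappa> + z i"] q1_bounds[of "\<kappa> + z i"]
    by (intro power_mono) (auto intro: mult_left_le)
  then show ?thesis unfolding G_sq by (intro add_increasing) (auto intro: sum_mono)
qed

text \<open>Like a Euclidean norm, \<open>G\<close> has a gradient of length at most 1, since
  \<open>q1 \<le> 1\<close> gives \<open>u \<le> q\<close>. This provides the sign in
  \<open>exp_comparison\<close>.\<close>

lemma sum_a1_sq: "(\<Sum>i<m. (a1 i z)\<^sup>2) \<le> 1"
proof -
  have "(\<Sum>i<m. (a1 i z)\<^sup>2) = (\<Sum>i<m. (u z i)\<^sup>2) / (G z)\<^sup>2"
    by (simp add: a1_def power_divide sum_divide_distrib)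
  also have "\<dots> \<le> 1" using sum_u_sq[of z] G_ge_1[of z] by (simp add: divide_le_eq)
  finally show ?thesis .
qed

lemma u_le_G: "i < m \<Longrightarrow> u z i \<le> G z"
proof -
  assume "i < m"
  then have "(u z i)\<^sup>2 \<le> (\<Sum>i<m. (u z i)\<^sup>2)" by (intro member_le_sum) auto
  also have "\<dots> \<le> (G z)\<^sup>2" by (rule sum_u_sq)
  finally show ?thesis by (rule power2_le_imp_le) (use G_ge_1[of z] in simp)
qed

lemma a1_bound: "\<bar>a1 i z\<bar> \<le> 1"
  using u_le_G[of i z] u_nonneg[of z i] G_ge_1[of z] by (auto simp: a1_def)

lemma a2_bound: "\<bar>a2 i j z\<bar> \<le> 3"
proof (cases "i < m \<and> j < m")
  case True
  have G: "1 \<le> G z" "0 < G z" using G_ge_1[of z] by auto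
  have "(q1 (\<kappa> + z i))\<^sup>2 \<le> 1"
    using q1_bounds[of "\<kappa> + z i"] by (simp add: power_le_one)
  moreover have "0 \<le> q (\<kappa> + z i) * q2 (\<kappa> + z i)"
    using q_nonneg q2_nonneg by (rule mult_nonneg_nonneg)
  ultimately have "0 \<le> u1 z i" "u1 z i \<le> 2"
    using q_q2_le[of "\<kappa> + z i"] unfolding u1_def by (simp_all add: add_nonneg_nonneg)
  then have 1: "0 \<le> u1 z i / G z" "u1 z i / G z \<le> 2"
    using G by (auto simp: divide_le_eq)
  have "u z i * u z j \<le> G z * G z"
    using True u_le_G u_nonneg G by (intro mult_mono) auto
  also have "\<dots> \<le> G z ^ 3"
    using G by (simp add: power3_eq_cube mult_le_cancel_right1)
  finally have "u z i * u z j / G z ^ 3 \<le> 1" using G by (simp add: divide_le_eq)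
  moreover have "0 \<le> u z i * u z j / G z ^ 3" using G u_nonneg by simp
  ultimately show ?thesis using 1 True by (auto simp: a2_def)
qed (auto simp: a2_def)

section \<open>Derivatives of the margin along curves\<close>

lemma DERIV_G:
  assumes "\<And>i. i \<le> m \<Longrightarrow> (\<gamma> i has_real_derivative \<gamma>' i) (at r)"
  shows "((\<lambda>r. G (\<lambda>i. \<gamma> i r)) has_real_derivative (\<Sum>i<m. a1 i (\<lambda>i. \<gamma> i r) * \<gamma>' i)) (at r)"
proof -
  let ?z = "\<lambda>i. \<gamma> i r"
  have d: "((\<lambda>r. 1 + (\<Sum>i<m. (q (\<kappa> + \<gamma> i r))\<^sup>2)) has_real_derivative (\<Sum>i<m. 2 * u ?z i * \<gamma>' i)) (at r)"
  proof -
    have "((\<lambda>r. 1 + (\<Sum>i<m. (q (\<kappa> + \<gamma> i r))\<^sup>2)) has_real_derivative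
        0 + (\<Sum>i<m. of_nat 2 * (q1 (\<kappa> + \<gamma> i r) * \<gamma>' i * q (\<kappa> + \<gamma> i r) ^ (2 - Suc 0)))) (at r)"
      using assms by (intro DERIV_add DERIV_const DERIV_sum DERIV_power DERIV_q_shift) auto
    then show ?thesis by (rule DERIV_cong) (simp add: u_def mult_ac)
  qed
  have "0 < (G ?z)\<^sup>2" using G_ge_1[of ?z] by simp
  then have "0 < 1 + (\<Sum>i<m. (q (\<kappa> + \<gamma> i r))\<^sup>2)" unfolding G_sq .
  from DERIV_chain2[OF DERIV_real_sqrt[OF this] d]
  have "((\<lambda>r. G (\<lambda>i. \<gamma> i r)) has_real_derivative inverse (G ?z) / 2 * (\<Sum>i<m. 2 * u ?z i * \<gamma>' i)) (at r)"
    unfolding G_def .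
  then show ?thesis
    by (rule DERIV_cong) (auto simp: a1_def sum_distrib_left field_simps intro!: sum.cong)
qed

lemma DERIV_a:
  assumes "\<And>i. i \<le> m \<Longrightarrow> (\<gamma> i has_real_derivative \<gamma>' i) (at r)"
  shows "((\<lambda>r. a (\<lambda>i. \<gamma> i r)) has_real_derivative (\<Sum>i\<le>m. a1 i (\<lambda>i. \<gamma> i r) * \<gamma>' i)) (at r)"
proof -
  have "((\<lambda>r. a (\<lambda>i. \<gamma> i r)) has_real_derivative (\<Sum>i<m. a1 i (\<lambda>i. \<gamma> i r) * \<gamma>' i) + \<gamma>' m) (at r)"
    unfolding a_def using assms by (intro DERIV_add DERIV_G) auto
  then show ?thesis by (simp add: lessThan_Suc_atMost[symmetric] a1_def[of m])
qed

lemma DERIV_a1: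
  assumes i: "i \<le> m" and \<gamma>: "\<And>i. i \<le> m \<Longrightarrow> (\<gamma> i has_real_derivative \<gamma>' i) (at r)"
  shows "((\<lambda>r. a1 i (\<lambda>i. \<gamma> i r)) has_real_derivative (\<Sum>j\<le>m. a2 i j (\<lambda>i. \<gamma> i r) * \<gamma>' j)) (at r)"
proof (cases "i < m")
  case True
  let ?z = "\<lambda>i. \<gamma> i r"
  have du: "((\<lambda>r. u (\<lambda>i. \<gamma> i r) i) has_real_derivative u1 ?z i * \<gamma>' i) (at r)"
    unfolding u_def
    by (rule DERIV_cong[OF DERIV_mult[OF DERIV_q_shift(1) DERIV_q_shift(2)]])
      (use \<gamma> i in \<open>auto simp: u1_def algebra_simps power2_eq_square\<close>)
  have G: "G ?z \<noteq> 0" using G_ge_1[of ?z] by simp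
  have "((\<lambda>r. a1 i (\<lambda>i. \<gamma> i r)) has_real_derivative
      (u1 ?z i * \<gamma>' i * G ?z - u ?z i * (\<Sum>j<m. a1 j ?z * \<gamma>' j)) / (G ?z * G ?z)) (at r)"
    unfolding a1_def[of i] using True G by (auto intro!: DERIV_divide du DERIV_G \<gamma>)
  moreover have "(u1 ?z i * \<gamma>' i * G ?z - u ?z i * (\<Sum>j<m. a1 j ?z * \<gamma>' j)) / (G ?z * G ?z)
     = (\<Sum>j\<le>m. a2 i j ?z * \<gamma>' j)"
  proof -
    have "(\<Sum>j\<le>m. a2 i j ?z * \<gamma>' j) = (\<Sum>j<m. a2 i j ?z * \<gamma>' j)"
      by (simp add: lessThan_Suc_atMost[symmetric] a2_def)
    also have "\<dots> = (\<Sum>j<m. (if i = j then u1 ?z i / G ?z * \<gamma>' j else 0) - u ?z i * u ?z j / G ?z ^ 3 * \<gamma>' j)"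
      using True by (intro sum.cong) (auto simp: a2_def algebra_simps)
    also have "\<dots> = u1 ?z i / G ?z * \<gamma>' i - (\<Sum>j<m. u ?z i * u ?z j / G ?z ^ 3 * \<gamma>' j)"
      using True by (simp add: sum_subtractf)
    also have "(\<Sum>j<m. u ?z i * u ?z j / G ?z ^ 3 * \<gamma>' j) = u ?z i * (\<Sum>j<m. a1 j ?z * \<gamma>' j) / (G ?z * G ?z)"
      by (auto simp: sum_distrib_left sum_divide_distrib a1_def power3_eq_cube intro!: sum.cong)
    finally show ?thesis using G by (simp add: diff_divide_distrib)
  qed
  ultimately show ?thesis by simp
qed (simp add: a1_def a2_def)

section \<open>The double exponential and its derivatives\<close>

definition e :: "(nat \<Rightarrow> real) \<Rightarrow> real" where "e z = exp (- \<beta> * (a z - t))"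

lemma e_pos: "0 < e z"
  by (simp add: e_def)

lemma DERIV_e:
  assumes "\<And>i. i \<le> m \<Longrightarrow> (\<gamma> i has_real_derivative \<gamma>' i) (at r)"
  shows "((\<lambda>r. e (\<lambda>i. \<gamma> i r)) has_real_derivative
      (\<Sum>i\<le>m. - \<beta> * e (\<lambda>i. \<gamma> i r) * a1 i (\<lambda>i. \<gamma> i r) * \<gamma>' i)) (at r)"
proof -
  have "((\<lambda>r. - \<beta> * (a (\<lambda>i. \<gamma> i r) - t)) has_real_derivative
      - \<beta> * (\<Sum>i\<le>m. a1 i (\<lambda>i. \<gamma> i r) * \<gamma>' i)) (at r)"
    by (auto intro!: derivative_eq_intros DERIV_a assms)
  from DERIV_chain2[OF DERIV_exp this] show ?thesis
    unfolding e_def by (rule DERIV_cong) (auto simp: sum_distrib_left mult_ac sum_negf intro!: sum.cong)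
qed

text \<open>A smooth indicator that \<open>a\<close> exceeds \<open>t\<close> at every point of
  \<open>X\<close>: one point well below \<open>t\<close> makes the inner sum huge, and points well
  above contribute almost nothing. The index \<open>(x, i)\<close> names coordinate \<open>i\<close>
  in the block of the point \<open>x\<close>.\<close>

definition \<Phi> :: "'x set \<Rightarrow> ('x \<times> nat \<Rightarrow> real) \<Rightarrow> real" where
  "\<Phi> X Z = exp (- (\<Sum>x\<in>X. e (\<lambda>i. Z (x, i))))"
definition \<Phi>1 :: "'x set \<Rightarrow> 'x \<times> nat \<Rightarrow> ('x \<times> nat \<Rightarrow> real) \<Rightarrow> real" where
  "\<Phi>1 X s Z = \<beta> * (\<Phi> X Z * e (\<lambda>i. Z (fst s, i)) * a1 (snd s) (\<lambda>i. Z (fst s, i)))"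
text \<open>For two different points only the product of the first derivatives of \<open>e\<close>
  survives. Second derivatives enter only inside one block, where the covariance difference in
  \<open>exp_comparison\<close> will be 0.\<close>

definition \<Phi>2 :: "'x set \<Rightarrow> 'x \<times> nat \<Rightarrow> 'x \<times> nat \<Rightarrow> ('x \<times> nat \<Rightarrow> real) \<Rightarrow> real" where
  "\<Phi>2 X s s' Z = \<beta> * \<Phi> X Z * e (\<lambda>i. Z (fst s, i)) *
     (\<beta> * e (\<lambda>i. Z (fst s', i)) * a1 (snd s') (\<lambda>i. Z (fst s', i)) * a1 (snd s) (\<lambda>i. Z (fst s, i))
      + (if fst s = fst s' then a2 (snd s) (snd s') (\<lambda>i. Z (fst s, i))
           - \<beta> * a1 (snd s) (\<lambda>i. Z (fst s, i)) * a1 (snd s') (\<lambda>i. Z (fst s, i)) else 0))"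

lemma DERIV_\<Phi>:
  assumes \<gamma>: "\<And>s. s \<in> X \<times> {..m} \<Longrightarrow> (\<gamma> s has_real_derivative \<gamma>' s) (at r)"
  shows "((\<lambda>r. \<Phi> X (\<lambda>s. \<gamma> s r)) has_real_derivative
      (\<Sum>s\<in>X \<times> {..m}. \<Phi>1 X s (\<lambda>s. \<gamma> s r) * \<gamma>' s)) (at r)"
proof -
  let ?z = "\<lambda>x i. \<gamma> (x, i) r"
  have "((\<lambda>r. - (\<Sum>x\<in>X. e (\<lambda>i. \<gamma> (x, i) r))) has_real_derivative
     - (\<Sum>x\<in>X. \<Sum>i\<le>m. - \<beta> * e (?z x) * a1 i (?z x) * \<gamma>' (x, i))) (at r)"
    using \<gamma> by (intro DERIV_minus DERIV_sum DERIV_e) auto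
  from DERIV_chain2[OF DERIV_exp this] show ?thesis
    unfolding \<Phi>_def \<Phi>1_def
    by (rule DERIV_cong)
      (auto simp: sum_distrib_left sum_negf sum.cartesian_product split_beta' mult_ac intro!: sum.cong)
qed

lemma DERIV_\<Phi>1:
  assumes X: "finite X" and s: "s \<in> X \<times> {..m}"
    and \<gamma>: "\<And>s. s \<in> X \<times> {..m} \<Longrightarrow> (\<gamma> s has_real_derivative \<gamma>' s) (at r)"
  shows "((\<lambda>r. \<Phi>1 X s (\<lambda>s. \<gamma> s r)) has_real_derivative
      (\<Sum>s'\<in>X \<times> {..m}. \<Phi>2 X s s' (\<lambda>s. \<gamma> s r) * \<gamma>' s')) (at r)"
proof -
  obtain x i where xi: "s = (x, i)" "x \<in> X" "i \<le> m" using s by auto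
  let ?Z = "\<lambda>s. \<gamma> s r" and ?z = "\<lambda>i. \<gamma> (x, i) r"
  have \<gamma>x: "(\<gamma> (x, j) has_real_derivative \<gamma>' (x, j)) (at r)" if "j \<le> m" for j
    using \<gamma>[of "(x, j)"] that xi by auto
  \<comment> \<open>The factors \<open>e\<close> and \<open>a1\<close> at \<open>s\<close> depend
    only on the block of \<open>x\<close>, so their derivatives must be embedded in a sum over all
    blocks.\<close>
  have dsub: "(\<Sum>s'\<in>X \<times> {..m}. (if x = fst s' then f s' else 0)) = (\<Sum>j\<le>m. f (x, j))" for f :: "_ \<Rightarrow> real"
  proof -
    have "(\<Sum>s'\<in>X \<times> {..m}. (if x = fst s' then f s' else 0)) = (\<Sum>y\<in>X. \<Sum>j\<le>m. (if x = y then f (y, j) else 0))"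
      unfolding sum_Times by simp
    also have "\<dots> = (\<Sum>y\<in>X. if x = y then (\<Sum>j\<le>m. f (y, j)) else 0)"
      by (intro sum.cong) auto
    finally show ?thesis using X xi by simp
  qed
  have "((\<lambda>r. \<Phi>1 X s (\<lambda>s. \<gamma> s r)) has_real_derivative
     \<beta> * (((\<Sum>s\<in>X \<times> {..m}. \<Phi>1 X s ?Z * \<gamma>' s) * e ?z + (\<Sum>j\<le>m. - \<beta> * e ?z * a1 j ?z * \<gamma>' (x, j)) * \<Phi> X ?Z) * a1 i ?z
       + (\<Sum>j\<le>m. a2 i j ?z * \<gamma>' (x, j)) * (\<Phi> X ?Z * e ?z))) (at r)"
    unfolding xi(1) \<Phi>1_def[of X "(x, i)"] fst_conv snd_conv
    using xi \<gamma> \<gamma>x by (intro DERIV_cmult DERIV_mult DERIV_\<Phi> DERIV_e DERIV_a1) auto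
  then show ?thesis
  proof (rule DERIV_cong)
    have "(\<Sum>s'\<in>X \<times> {..m}. \<Phi>2 X s s' ?Z * \<gamma>' s') =
       (\<Sum>s'\<in>X \<times> {..m}. (\<beta> * e ?z * a1 i ?z) * (\<Phi>1 X s' ?Z * \<gamma>' s')
         + (if x = fst s' then (\<beta> * (\<Phi> X ?Z * e ?z)) * (a2 i (snd s') ?z * \<gamma>' s')
             + (\<beta> * \<Phi> X ?Z * a1 i ?z) * (- \<beta> * e ?z * a1 (snd s') ?z * \<gamma>' s') else 0))"
      by (intro sum.cong) (auto simp: \<Phi>2_def \<Phi>1_def xi algebra_simps)
    also have "\<dots> = \<beta> * e ?z * a1 i ?z * (\<Sum>s'\<in>X \<times> {..m}. \<Phi>1 X s' ?Z * \<gamma>' s')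
        + (\<beta> * (\<Phi> X ?Z * e ?z) * (\<Sum>j\<le>m. a2 i j ?z * \<gamma>' (x, j))
        + \<beta> * \<Phi> X ?Z * a1 i ?z * (\<Sum>j\<le>m. - \<beta> * e ?z * a1 j ?z * \<gamma>' (x, j)))"
      unfolding sum.distrib dsub snd_conv sum_distrib_left ..
    finally show "\<beta> * (((\<Sum>s\<in>X \<times> {..m}. \<Phi>1 X s ?Z * \<gamma>' s) * e ?z + (\<Sum>j\<le>m. - \<beta> * e ?z * a1 j ?z * \<gamma>' (x, j)) * \<Phi> X ?Z) * a1 i ?z
       + (\<Sum>j\<le>m. a2 i j ?z * \<gamma>' (x, j)) * (\<Phi> X ?Z * e ?z)) = (\<Sum>s'\<in>X \<times> {..m}. \<Phi>2 X s s' ?Z * \<gamma>' s')"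
      by (simp add: algebra_simps)
  qed
qed

section \<open>Measurability and uniform bounds of the double exponential\<close>

lemma q_measurable [measurable]: "q \<in> borel_measurable borel" "q1 \<in> borel_measurable borel" "q2 \<in> borel_measurable borel"
  unfolding q_def[abs_def] q1_def[abs_def] q2_def[abs_def] by measurable

lemma e_measurable: "(\<lambda>Z. e (\<lambda>i. Z (x, i))) \<in> borel_measurable (Pi\<^sub>M UNIV (\<lambda>_. borel))"
  unfolding e_def a_def G_def by measurable

lemma a1_measurable: "(\<lambda>Z. a1 j (\<lambda>i. Z (x, i))) \<in> borel_measurable (Pi\<^sub>M UNIV (\<lambda>_. borel))"
  unfolding a1_def u_def G_def by measurable

lemma a2_measurable: "(\<lambda>Z. a2 j k (\<lambda>i. Z (x, i))) \<in> borel_measurable (Pi\<^sub>M UNIV (\<lambda>_. borel))"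
  unfolding a2_def u_def u1_def G_def by measurable

lemma \<Phi>_measurable [measurable]: "\<Phi> X \<in> borel_measurable (Pi\<^sub>M UNIV (\<lambda>_. borel))"
  unfolding \<Phi>_def[abs_def] by (intro measurable_compose[OF _ borel_measurable_exp] borel_measurable_uminus borel_measurable_sum e_measurable)

lemma \<Phi>1_measurable [measurable]: "\<Phi>1 X s \<in> borel_measurable (Pi\<^sub>M UNIV (\<lambda>_. borel))"
  unfolding \<Phi>1_def[abs_def] using e_measurable a1_measurable by measurable

lemma \<Phi>2_measurable [measurable]: "\<Phi>2 X s s' \<in> borel_measurable (Pi\<^sub>M UNIV (\<lambda>_. borel))"
  unfolding \<Phi>2_def[abs_def] using e_measurable a1_measurable a2_measurable by measurable

lemma \<Phi>_bounds: "0 < \<Phi> X Z" "\<Phi> X Z \<le> 1"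
  unfolding \<Phi>_def using e_pos by (auto intro!: sum_nonneg simp: less_imp_le)

text \<open>\<open>e\<close> alone is unbounded, but with \<open>S\<close> the sum of all
  \<open>e\<close> the product is at most \<open>S * exp (- S)\<close>, hence at most 1.\<close>

lemma \<Phi>_e_le: "finite X \<Longrightarrow> x \<in> X \<Longrightarrow> \<Phi> X Z * e (\<lambda>i. Z (x, i)) \<le> 1"
proof -
  assume X: "finite X" "x \<in> X"
  let ?S = "\<Sum>x\<in>X. e (\<lambda>i. Z (x, i))"
  have "e (\<lambda>i. Z (x, i)) \<le> ?S" using X e_pos by (intro member_le_sum) (auto simp: less_imp_le)
  also have "?S \<le> exp ?S" using exp_ge_add_one_self[of ?S] by linarith
  finally have "\<Phi> X Z * e (\<lambda>i. Z (x, i)) \<le> \<Phi> X Z * exp ?S"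
    using \<Phi>_bounds(1)[of X Z] by (intro mult_left_mono) auto
  then show ?thesis by (simp add: \<Phi>_def flip: exp_add)
qed

text \<open>The same idea with two factors: \<open>S\<^sup>2 * exp (- S)\<close> is at most 2 by the
  quadratic term of the exponential series.\<close>

lemma \<Phi>_e_e_le:
  assumes X: "finite X" "x \<in> X" "y \<in> X"
  shows "\<Phi> X Z * e (\<lambda>i. Z (x, i)) * e (\<lambda>i. Z (y, i)) \<le> 2"
proof -
  let ?S = "\<Sum>x\<in>X. e (\<lambda>i. Z (x, i))"
  have S: "e (\<lambda>i. Z (x, i)) \<le> ?S" if "x \<in> X" for x
    using X e_pos that by (intro member_le_sum) (auto simp: less_imp_le)
  then have S0: "0 \<le> ?S" using e_pos[of "\<lambda>i. Z (x, i)"] X(2) by (meson less_imp_le order.trans)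
  have "e (\<lambda>i. Z (x, i)) * e (\<lambda>i. Z (y, i)) \<le> ?S * ?S"
    using S X e_pos S0 by (intro mult_mono) (auto simp: less_imp_le)
  also have "\<dots> \<le> 2 * exp ?S"
    using exp_lower_Taylor_quadratic[OF S0] S0 by (simp add: power2_eq_square)
  finally have "\<Phi> X Z * (e (\<lambda>i. Z (x, i)) * e (\<lambda>i. Z (y, i))) \<le> \<Phi> X Z * (2 * exp ?S)"
    using \<Phi>_bounds(1)[of X Z] by (intro mult_left_mono) auto
  also have "\<dots> = 2" by (simp add: \<Phi>_def flip: exp_add)
  finally show ?thesis by (simp add: mult.assoc)
qed

lemma \<Phi>1_bound:
  assumes X: "finite X" "s \<in> X \<times> {..m}"
  shows "\<bar>\<Phi>1 X s Z\<bar> \<le> \<beta>"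
proof -
  let ?w = "\<Phi> X Z * e (\<lambda>i. Z (fst s, i))"
  have "0 \<le> ?w" "?w \<le> 1" using \<Phi>_bounds(1)[of X Z] e_pos X by (auto intro!: \<Phi>_e_le simp: less_imp_le)
  then have "\<bar>?w * a1 (snd s) (\<lambda>i. Z (fst s, i))\<bar> \<le> 1 * 1"
    unfolding abs_mult[of ?w] by (intro mult_mono a1_bound) auto
  then show ?thesis using beta_pos unfolding \<Phi>1_def abs_mult[of \<beta>]
    by (simp add: mult_left_le)
qed

text \<open>Inside the outer factor \<open>\<beta>\<close>, the weight with two \<open>e\<close>
  contributes at most \<open>2 * \<beta>\<close>, and the weight with one \<open>e\<close> at most
  \<open>3 + \<beta>\<close>, by \<open>a2_bound\<close> and \<open>a1_bound\<close>.\<close>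

lemma \<Phi>2_bound:
  assumes X: "finite X" "s \<in> X \<times> {..m}" "s' \<in> X \<times> {..m}"
  shows "\<bar>\<Phi>2 X s s' Z\<bar> \<le> \<beta> * (3 * \<beta> + 3)"
proof -
  let ?w = "\<Phi> X Z * e (\<lambda>i. Z (fst s, i))"
  let ?w2 = "\<Phi> X Z * e (\<lambda>i. Z (fst s, i)) * e (\<lambda>i. Z (fst s', i))"
  let ?p = "a1 (snd s) (\<lambda>i. Z (fst s, i))" and ?p' = "a1 (snd s') (\<lambda>i. Z (fst s', i))"
    and ?p'' = "a1 (snd s') (\<lambda>i. Z (fst s, i))"
  let ?c = "if fst s = fst s' then a2 (snd s) (snd s') (\<lambda>i. Z (fst s, i)) - \<beta> * (?p * ?p'') else 0"
  have w: "0 \<le> ?w" "?w \<le> 1" using \<Phi>_bounds(1)[of X Z] e_pos X by (auto intro!: \<Phi>_e_le simp: less_imp_le)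
  have w2: "0 \<le> ?w2" "?w2 \<le> 2" using \<Phi>_bounds(1)[of X Z] e_pos X by (auto intro!: \<Phi>_e_e_le simp: less_imp_le)
  have pp: "\<bar>?p * ?p'\<bar> \<le> 1 * 1" "\<bar>?p * ?p''\<bar> \<le> 1 * 1"
    unfolding abs_mult by (intro mult_mono a1_bound; simp)+
  have "\<bar>\<beta> * (?p * ?p'')\<bar> \<le> \<beta>" using pp(2) beta_pos by (simp add: abs_mult mult_left_le)
  then have c: "\<bar>?c\<bar> \<le> 3 + \<beta>"
    using a2_bound[of "snd s" "snd s'" "\<lambda>i. Z (fst s, i)"] beta_pos by auto
  have w2p: "\<bar>?w2 * (?p * ?p')\<bar> \<le> 2 * 1"
    unfolding abs_mult[of ?w2] using w2 pp by (intro mult_mono) auto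
  then have 1: "\<bar>\<beta> * (?w2 * (?p * ?p'))\<bar> \<le> \<beta> * (2 * 1)"
    unfolding abs_mult[of \<beta>] abs_of_pos[OF beta_pos] by (rule mult_left_mono) (use beta_pos in simp)
  have 2: "\<bar>?w * ?c\<bar> \<le> 1 * (3 + \<beta>)" unfolding abs_mult[of ?w] using w c by (intro mult_mono) auto
  have "\<bar>\<beta> * (?w2 * (?p * ?p')) + ?w * ?c\<bar> \<le> \<beta> * (2 * 1) + 1 * (3 + \<beta>)"
    using 1 2 by (rule order.trans[OF abs_triangle_ineq add_mono])
  also have "\<dots> = 3 * \<beta> + 3" by simp
  finally have **: "\<bar>\<beta> * (?w2 * (?p * ?p')) + ?w * ?c\<bar> \<le> 3 * \<beta> + 3" .
  have *: "\<Phi>2 X s s' Z = \<beta> * (\<beta> * (?w2 * (?p * ?p')) + ?w * ?c)"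
    unfolding \<Phi>2_def by (simp add: algebra_simps)
  from ** show ?thesis
    unfolding * abs_mult[of \<beta>] abs_of_pos[OF beta_pos]
    by (intro mult_left_mono) (use beta_pos in simp_all)
qed

text \<open>The covariances differ only between equal coordinates, by \<open>c x y - 1\<close> in
  the vector part and \<open>1 - c x y\<close> in the scalar part. Hence the sum demanded by
  \<open>gaussian_comparison\<close> collapses to \<open>1 - c x y\<close> times the scalar second
  derivative minus the sum of the vector ones.\<close>

theorem exp_comparison:
  fixes A B :: "'x \<times> nat \<Rightarrow> 'k \<Rightarrow> real" and c :: "'x \<Rightarrow> 'x \<Rightarrow> real"
  assumes I: "finite I" and X: "finite X"
    and AB: "\<And>s s'. s \<in> X \<times> {..m} \<Longrightarrow> s' \<in> X \<times> {..m} \<Longrightarrow> (\<Sum>k\<in>I. A s k * B s' k) = 0"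
    and cov: "\<And>x y i j. x \<in> X \<Longrightarrow> y \<in> X \<Longrightarrow> i \<le> m \<Longrightarrow> j \<le> m \<Longrightarrow>
        (\<Sum>k\<in>I. B (x, i) k * B (y, j) k) - (\<Sum>k\<in>I. A (x, i) k * A (y, j) k)
          = (if i \<noteq> j then 0 else if i < m then c x y - 1 else 1 - c x y)"
    and c: "\<And>x. x \<in> X \<Longrightarrow> c x x = 1" "\<And>x y. x \<in> X \<Longrightarrow> y \<in> X \<Longrightarrow> c x y \<le> 1"
  shows "(\<integral>w. \<Phi> X (\<lambda>s. \<Sum>k\<in>I. A s k * w k) \<partial>gauss_PiM I) \<le> (\<integral>w. \<Phi> X (\<lambda>s. \<Sum>k\<in>I. B s k * w k) \<partial>gauss_PiM I)"
proof (rule gaussian_comparison[where S="X \<times> {..m}" and \<Phi>'="\<Phi>1 X" and \<Phi>''="\<Phi>2 X" and C="1 + \<beta> + \<beta> * (3 * \<beta> + 3)"])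
  fix Z :: "'x \<times> nat \<Rightarrow> real"
  let ?z = "\<lambda>x i. Z (x, i)"
  let ?d = "\<lambda>s s'. (\<Sum>k\<in>I. B s k * B s' k) - (\<Sum>k\<in>I. A s k * A s' k)"
  have "(\<Sum>s\<in>X \<times> {..m}. \<Sum>s'\<in>X \<times> {..m}. ?d s s' * \<Phi>2 X s s' Z)
    = (\<Sum>x\<in>X. \<Sum>i\<le>m. \<Sum>y\<in>X. \<Sum>j\<le>m. ?d (x, i) (y, j) * \<Phi>2 X (x, i) (y, j) Z)"
    unfolding sum_Times ..
  also have "\<dots> = (\<Sum>x\<in>X. \<Sum>i\<le>m. \<Sum>y\<in>X. \<Sum>j\<le>m. if i = j then (if i < m then c x y - 1 else 1 - c x y) * \<Phi>2 X (x, i) (y, i) Z else 0)"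
    by (intro sum.cong refl) (simp add: cov)
  also have "\<dots> = (\<Sum>x\<in>X. \<Sum>y\<in>X. \<Sum>i\<le>m. (if i < m then c x y - 1 else 1 - c x y) * \<Phi>2 X (x, i) (y, i) Z)"
    by (intro sum.cong refl) (subst sum.swap, simp)
  also have "\<dots> \<ge> 0"
  proof (rule sum_nonneg, rule sum_nonneg)
    fix x y assume xy: "x \<in> X" "y \<in> X"
    have "(\<Sum>i\<le>m. (if i < m then c x y - 1 else 1 - c x y) * \<Phi>2 X (x, i) (y, i) Z)
      = (1 - c x y) * (\<Phi>2 X (x, m) (y, m) Z - (\<Sum>i<m. \<Phi>2 X (x, i) (y, i) Z))"
      by (simp add: lessThan_Suc_atMost[symmetric] sum_distrib_left algebra_simps sum_subtractf)
    also have "\<dots> \<ge> 0"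
    \<comment> \<open>For equal points \<open>c x x = 1\<close> removes the term together with the
      second derivatives of \<open>G\<close>. For different points the remaining factor is 1 minus
      the inner product of two gradients of length at most 1.\<close>
    proof (cases "x = y")
      case False
      have "(\<Sum>i<m. a1 i (?z y) * a1 i (?z x)) \<le> (\<Sum>i<m. ((a1 i (?z x))\<^sup>2 + (a1 i (?z y))\<^sup>2) / 2)"
      proof (rule sum_mono)
        fix i show "a1 i (?z y) * a1 i (?z x) \<le> ((a1 i (?z x))\<^sup>2 + (a1 i (?z y))\<^sup>2) / 2"
          using sum_squares_bound[of "a1 i (?z x)" "a1 i (?z y)"] by (simp add: mult_ac)
      qed
      also have "\<dots> \<le> 1"
        using sum_a1_sq[of "?z x"] sum_a1_sq[of "?z y"] by (simp add: sum.distrib flip: sum_divide_distrib)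
      finally have le: "(\<Sum>i<m. a1 i (?z y) * a1 i (?z x)) \<le> 1" .
      have "\<Phi>2 X (x, m) (y, m) Z - (\<Sum>i<m. \<Phi>2 X (x, i) (y, i) Z)
        = \<beta> * \<beta> * \<Phi> X Z * e (?z x) * e (?z y) * (1 - (\<Sum>i<m. a1 i (?z y) * a1 i (?z x)))"
        unfolding \<Phi>2_def using False by (simp add: a1_def[of m] sum_distrib_left algebra_simps)
      also have "\<dots> \<ge> 0"
        using le beta_pos \<Phi>_bounds(1)[of X Z] e_pos by (intro mult_nonneg_nonneg) (auto simp: less_imp_le)
      finally show ?thesis using c(2)[OF xy] by simp
    qed (use c xy in simp)
    finally show "0 \<le> (\<Sum>i\<le>m. (if i < m then c x y - 1 else 1 - c x y) * \<Phi>2 X (x, i) (y, i) Z)" .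
  qed
  finally show "0 \<le> (\<Sum>s\<in>X \<times> {..m}. \<Sum>s'\<in>X \<times> {..m}. ?d s s' * \<Phi>2 X s s' Z)" .
next
  fix Z :: "'x \<times> nat \<Rightarrow> real" and s s' :: "'x \<times> nat"
  show "\<bar>\<Phi> X Z\<bar> \<le> 1 + \<beta> + \<beta> * (3 * \<beta> + 3)"
    using \<Phi>_bounds[of X Z] beta_pos by (simp add: add_increasing2)
  assume s: "s \<in> X \<times> {..m}"
  show "\<bar>\<Phi>1 X s Z\<bar> \<le> 1 + \<beta> + \<beta> * (3 * \<beta> + 3)"
    using \<Phi>1_bound[OF X s, of Z] beta_pos by (simp add: add_increasing2)
  assume s': "s' \<in> X \<times> {..m}"
  show "\<bar>\<Phi>2 X s s' Z\<bar> \<le> 1 + \<beta> + \<beta> * (3 * \<beta> + 3)"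
    using \<Phi>2_bound[OF X s s', of Z] beta_pos by simp
qed (use I X AB in \<open>auto intro!: DERIV_\<Phi> DERIV_\<Phi>1\<close>)

end

subsection \<open>Gordon's inequality for the hypercube\<close>

text \<open>Each coordinate has only two possible values. The cardinality enters as a union bound,
  later against an exponential of order \<open>n\<close> to the power 3/2.\<close>

lemma finite_cube_pm1: "finite (cube_pm1 n)" and card_cube_pm1_le: "card (cube_pm1 n) \<le> 2 ^ n"
proof -
  let ?S = "{..<n} \<rightarrow>\<^sub>E {1 / sqrt (real n), - 1 / sqrt (real n)}"
  have sub: "cube_pm1 n \<subseteq> ?S"
  proof
    fix x assume x: "x \<in> cube_pm1 n"
    have "x i = 1 / sqrt (real n) \<or> x i = - 1 / sqrt (real n)" if "i < n" for i
    proof -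
      have "(x i)\<^sup>2 = (1 / sqrt (real n))\<^sup>2"
        using x that by (auto simp: cube_pm1_def power_divide)
      then show ?thesis by (auto simp: power2_eq_iff)
    qed
    with x show "x \<in> ?S" by (auto simp: cube_pm1_def PiE_iff)
  qed
  have fin: "finite ?S" by (intro finite_PiE) auto
  then show "finite (cube_pm1 n)" using sub by (rule finite_subset[rotated])
  have "card (cube_pm1 n) \<le> card ?S" using fin sub by (rule card_mono)
  also have "\<dots> = (\<Prod>i<n. card {1 / sqrt (real n), - 1 / sqrt (real n)})" by (intro card_PiE) auto
  also have "\<dots> \<le> (\<Prod>i<n. 2)" by (intro prod_mono) (auto simp: card_insert_if)
  finally show "card (cube_pm1 n) \<le> 2 ^ n" by simp
qed

lemma cube_pm1_sum_sq:
  assumes "x \<in> cube_pm1 n" "0 < n"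
  shows "(\<Sum>l<n. (x l)\<^sup>2) = 1"
  using assms by (simp add: cube_pm1_def)

lemma cube_pm1_abs:
  assumes "x \<in> cube_pm1 n" "l < n"
  shows "\<bar>x l\<bar> = 1 / sqrt (real n)"
proof -
  have "\<bar>x l\<bar> = sqrt ((x l)\<^sup>2)" by simp
  also have "\<dots> = 1 / sqrt (real n)" using assms by (simp add: cube_pm1_def real_sqrt_divide)
  finally show ?thesis .
qed

lemma cube_pm1_inner_le:
  assumes "x \<in> cube_pm1 n" "y \<in> cube_pm1 n" "0 < n"
  shows "(\<Sum>l<n. x l * y l) \<le> 1"
proof -
  have "(\<Sum>l<n. x l * y l) \<le> (\<Sum>l<n. ((x l)\<^sup>2 + (y l)\<^sup>2) / 2)"
  proof (rule sum_mono)
    fix l show "x l * y l \<le> ((x l)\<^sup>2 + (y l)\<^sup>2) / 2" using sum_squares_bound[of "x l" "y l"] by simp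
  qed
  also have "\<dots> = 1" using assms by (simp add: sum.distrib cube_pm1_sum_sq flip: sum_divide_distrib)
  finally show ?thesis .
qed

text \<open>
  In the index set \<open>{..m} \<times> {..n}\<close> of the Gaussian space the block \<open>i < m, l < n\<close> carries the
  matrix, the last column and the last row carry the two vectors of the decoupled process, and the
  corner carries the scalar that equalises the variances.
\<close>

definition decoupled :: "nat \<Rightarrow> nat \<Rightarrow> (nat \<Rightarrow> real) \<times> nat \<Rightarrow> nat \<times> nat \<Rightarrow> real" where
  "decoupled m n = (\<lambda>(x, i) (k, l). if k \<noteq> i then 0 else
     if i < m then of_bool (l = n) else if l < n then x l else 0)"

text \<open>The first \<open>m\<close> coordinates form the negative of the matrix applied to
  \<open>x\<close>, the last one is the added scalar. The entries used are disjoint from those used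
  by \<open>decoupled\<close>, which makes the two families independent.\<close>

definition coupled :: "nat \<Rightarrow> nat \<Rightarrow> (nat \<Rightarrow> real) \<times> nat \<Rightarrow> nat \<times> nat \<Rightarrow> real" where
  "coupled m n = (\<lambda>(x, i) (k, l). if k \<noteq> i then 0 else
     if i < m then if l < n then - x l else 0 else of_bool (l = n))"

lemma sum_row:
  fixes f g :: "nat \<times> nat \<Rightarrow> real"
  assumes "i \<le> m" "\<And>k l. k \<noteq> i \<Longrightarrow> f (k, l) = 0"
  shows "(\<Sum>k\<in>{..m} \<times> {..n}. f k * g k) = (\<Sum>l<n. f (i, l) * g (i, l)) + f (i, n) * g (i, n)"
proof -
  have "(\<Sum>k\<in>{..m} \<times> {..n}. f k * g k) = (\<Sum>k\<le>m. if k = i then \<Sum>l\<le>n. f (k, l) * g (k, l) else 0)"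
    unfolding sum_Times by (intro sum.cong) (auto simp: assms(2))
  also have "\<dots> = (\<Sum>l\<le>n. f (i, l) * g (i, l))" using assms(1) by simp
  finally show ?thesis by (simp add: lessThan_Suc_atMost[symmetric])
qed

lemma decoupled_sum:
  assumes "i \<le> m"
  shows "(\<Sum>k\<in>{..m} \<times> {..n}. decoupled m n (x, i) k * g k) =
    (if i < m then g (i, n) else \<Sum>l<n. x l * g (m, l))"
  using assms by (subst sum_row[where i=i]) (auto simp: decoupled_def)

lemma coupled_sum:
  assumes "i \<le> m"
  shows "(\<Sum>k\<in>{..m} \<times> {..n}. coupled m n (x, i) k * g k) =
    (if i < m then - (\<Sum>l<n. x l * g (i, l)) else g (m, n))"
  using assms by (subst sum_row[where i=i]) (auto simp: coupled_def sum_negf)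

section \<open>From the comparison of expectations to probabilities\<close>

context smoothing
begin

text \<open>The price of smoothing: 1 from the summand under the root, and by Minkowski's inequality
  the norm of the constant vector \<open>\<eta> / 2\<close>.\<close>

lemma G_le: "G z \<le> 1 + sqrt (\<Sum>i<m. (max 0 (\<kappa> + z i))\<^sup>2) + \<eta> / 2 * sqrt (real m)"
proof -
  have "G z \<le> sqrt 1 + sqrt (\<Sum>i<m. (q (\<kappa> + z i))\<^sup>2)"
    unfolding G_def by (rule sqrt_add_le_add_sqrt) (auto intro: sum_nonneg)
  also have "sqrt (\<Sum>i<m. (q (\<kappa> + z i))\<^sup>2) \<le> L2_set (\<lambda>i. max 0 (\<kappa> + z i) + \<eta> / 2) {..<m}"
    unfolding L2_set_def using q_le q_nonneg
    by (intro real_sqrt_le_mono sum_mono power_mono) auto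
  also have "\<dots> \<le> L2_set (\<lambda>i. max 0 (\<kappa> + z i)) {..<m} + L2_set (\<lambda>i. \<eta> / 2) {..<m}"
    by (rule L2_set_triangle_ineq)
  also have "L2_set (\<lambda>i. \<eta> / 2) {..<m} = \<eta> / 2 * sqrt (real m)"
    using eta_pos by (simp add: L2_set_constant)
  finally show ?thesis by (simp add: L2_set_def add.assoc)
qed

lemma G_ge: "sqrt (\<Sum>i<m. (max 0 (\<kappa> + z i))\<^sup>2) \<le> G z"
  unfolding G_def using q_ge
  by (intro real_sqrt_le_mono add_increasing sum_mono power_mono) auto

text \<open>\<open>\<Phi>\<close> is bounded below on the decoupled event, where all
  \<open>e\<close> are at most \<open>exp (- \<beta> * d)\<close>, and bounded above off the coupled
  event, where a single \<open>e\<close> is at least \<open>exp (\<beta> * d)\<close>. The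
  hypothesis \<open>r\<close> pays for the smoothing, for a scalar of size up to \<open>s\<close>,
  and for the gap \<open>d\<close> below \<open>t\<close>; the comparison links the two
  expectations.\<close>

theorem gordon_prob_bound:
  fixes r d s :: real and n :: nat
  assumes n: "0 < n"
    and r: "r + \<eta> / 2 * sqrt (real m) + 1 + s \<le> t - d"
  defines "P \<equiv> gauss_PiM ({..m} \<times> {..n})"
  shows "measure P {w \<in> space P. t + d \<le> sqrt (\<Sum>i<m. (max 0 (\<kappa> + w (i, n)))\<^sup>2) - (\<Sum>l<n. \<bar>w (m, l)\<bar>) / sqrt (real n)}
      * exp (- (2 ^ n * exp (- \<beta> * d)))
    \<le> measure P {w \<in> space P. \<forall>x\<in>cube_pm1 n. r \<le> sqrt (\<Sum>i<m. (max 0 (\<kappa> - (\<Sum>l<n. w (i, l) * x l)))\<^sup>2)}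
      + measure P {w \<in> space P. s \<le> w (m, n)} + exp (- exp (\<beta> * d))"
proof -
  let ?I = "{..m} \<times> {..n}"
  let ?X = "cube_pm1 n"
  let ?A = "\<lambda>w s. \<Sum>k\<in>?I. decoupled m n s k * w k"
  let ?B = "\<lambda>w s. \<Sum>k\<in>?I. coupled m n s k * w k"
  define EA where "EA = {w \<in> space P. t + d \<le> sqrt (\<Sum>i<m. (max 0 (\<kappa> + w (i, n)))\<^sup>2) - (\<Sum>l<n. \<bar>w (m, l)\<bar>) / sqrt (real n)}"
  define EB where "EB = {w \<in> space P. \<forall>x\<in>?X. r \<le> sqrt (\<Sum>i<m. (max 0 (\<kappa> - (\<Sum>l<n. w (i, l) * x l)))\<^sup>2)}"
  define E0 where "E0 = {w \<in> space P. s \<le> w (m, n)}"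
  interpret P: prob_space P unfolding P_def by (rule gauss_PiM.P.prob_space_axioms)
  have fin: "finite ?X" by (rule finite_cube_pm1)
  have comp [measurable]: "k \<in> ?I \<Longrightarrow> (\<lambda>w. w k) \<in> borel_measurable P" for k
    unfolding P_def by (rule gauss_PiM_component_measurable)
  have comp' [measurable]: "(\<lambda>w. w (i, l)) \<in> borel_measurable P" if "i \<le> m" "l \<le> n" for i l
    using that by (intro comp) auto
  have [measurable]: "EA \<in> sets P" "E0 \<in> sets P" unfolding EA_def E0_def by (measurable; simp)+
  have [measurable]: "EB \<in> sets P"
    unfolding EB_def using fin by (intro sets.sets_Collect_finite_All) (measurable; simp)+
  have meas: "(\<lambda>w. \<Phi> ?X (\<lambda>s. \<Sum>k\<in>?I. F s k * w k)) \<in> borel_measurable P" for F :: "_ \<Rightarrow> _ \<Rightarrow> real"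
    by (rule measurable_compose[OF _ \<Phi>_measurable], rule measurable_PiM_single')
      (auto intro!: borel_measurable_sum comp)
  have int: "integrable P (\<lambda>w. \<Phi> ?X (\<lambda>s. \<Sum>k\<in>?I. F s k * w k))" for F :: "_ \<Rightarrow> _ \<Rightarrow> real"
    using \<Phi>_bounds[of ?X] by (intro prob_space_integrable_bounded[where C=1] meas P.prob_space_axioms) (auto simp: less_imp_le abs_of_pos)
  have cmp: "(\<integral>w. \<Phi> ?X (?A w) \<partial>P) \<le> (\<integral>w. \<Phi> ?X (?B w) \<partial>P)"
    unfolding P_def
  \<comment> \<open>Two points of the coupled family have covariance equal to their inner product in
    each vector coordinate and 1 in the scalar; for the decoupled family the roles are
    reversed.\<close>
  proof (rule exp_comparison[where c="\<lambda>x y. \<Sum>l<n. x l * y l"])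
    fix s s' assume s: "s \<in> ?X \<times> {..m}" "s' \<in> ?X \<times> {..m}"
    obtain x i y j where "s = (x, i)" "i \<le> m" "s' = (y, j)" "j \<le> m" using s by auto
    then show "(\<Sum>k\<in>?I. decoupled m n s k * coupled m n s' k) = 0"
      by (auto simp: decoupled_sum) (auto simp: coupled_def intro!: sum.neutral)
  next
    fix x y i j assume ij: "i \<le> m" "j \<le> m"
    show "(\<Sum>k\<in>?I. coupled m n (x, i) k * coupled m n (y, j) k) - (\<Sum>k\<in>?I. decoupled m n (x, i) k * decoupled m n (y, j) k)
      = (if i \<noteq> j then 0 else if i < m then (\<Sum>l<n. x l * y l) - 1 else 1 - (\<Sum>l<n. x l * y l))"
      using ij by (auto simp: decoupled_sum coupled_sum) (auto simp: decoupled_def coupled_def sum_negf)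
  next
    fix x y assume "x \<in> ?X" "y \<in> ?X"
    then show "(\<Sum>l<n. x l * x l) = 1" "(\<Sum>l<n. x l * y l) \<le> 1"
      using n cube_pm1_sum_sq cube_pm1_inner_le by (auto simp: power2_eq_square)
  qed (use fin in auto)
  have lower: "indicator EA w * exp (- (2 ^ n * exp (- \<beta> * d))) \<le> \<Phi> ?X (?A w)" for w
  proof (cases "w \<in> EA")
    case True
    have "e (\<lambda>i. ?A w (x, i)) \<le> exp (- \<beta> * d)" if x: "x \<in> ?X" for x
    proof -
      \<comment> \<open>As all entries of \<open>x\<close> have modulus 1 over the root of
        \<open>n\<close>, the linear form is bounded below by a multiple of the 1-norm, uniformly in
        \<open>x\<close>.\<close>
      have "- (\<Sum>l<n. \<bar>w (m, l)\<bar>) / sqrt (real n) = (\<Sum>l<n. - (\<bar>w (m, l)\<bar> / sqrt (real n)))"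
        by (simp add: sum_negf flip: sum_divide_distrib)
      also have "\<dots> \<le> (\<Sum>l<n. x l * w (m, l))"
      proof (rule sum_mono)
        fix l assume "l \<in> {..<n}"
        then have "\<bar>x l * w (m, l)\<bar> = \<bar>w (m, l)\<bar> / sqrt (real n)"
          using cube_pm1_abs[OF x] by (simp add: abs_mult)
        then show "- (\<bar>w (m, l)\<bar> / sqrt (real n)) \<le> x l * w (m, l)" by linarith
      qed
      also have "\<dots> = ?A w (x, m)" by (simp add: decoupled_sum)
      finally have 1: "- (\<Sum>l<n. \<bar>w (m, l)\<bar>) / sqrt (real n) \<le> ?A w (x, m)" .
      have "sqrt (\<Sum>i<m. (max 0 (\<kappa> + w (i, n)))\<^sup>2) = sqrt (\<Sum>i<m. (max 0 (\<kappa> + ?A w (x, i)))\<^sup>2)"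
        by (simp add: decoupled_sum)
      also have "\<dots> \<le> G (\<lambda>i. ?A w (x, i))" by (rule G_ge)
      finally have "d \<le> a (\<lambda>i. ?A w (x, i)) - t" using True 1 unfolding EA_def a_def by auto
      then show ?thesis unfolding e_def using beta_pos by simp
    qed
    then have "(\<Sum>x\<in>?X. e (\<lambda>i. ?A w (x, i))) \<le> real (card ?X) * exp (- \<beta> * d)"
      by (rule sum_bounded_above)
    also have "\<dots> \<le> 2 ^ n * exp (- \<beta> * d)"
    proof (rule mult_right_mono)
      have "real (card ?X) \<le> real (2 ^ n)" using card_cube_pm1_le by (rule of_nat_mono)
      then show "real (card ?X) \<le> 2 ^ n" by simp
    qed simp
    finally show ?thesis using True by (simp add: \<Phi>_def)
  qed (use \<Phi>_bounds[of ?X "?A w"] in simp)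
  have upper: "\<Phi> ?X (?B w) \<le> indicator EB w + indicator E0 w + exp (- exp (\<beta> * d))" if w: "w \<in> space P" for w
  proof (cases "w \<in> EB \<or> w \<in> E0")
    case True
    then show ?thesis using \<Phi>_bounds(2)[of ?X "?B w"] exp_ge_zero[of "- exp (\<beta> * d)"]
      by (auto simp: indicator_def intro: add_increasing2)
  next
    \<comment> \<open>Off both events some \<open>x\<close> has a small positive part and the scalar
      is below \<open>s\<close>. The term of this \<open>x\<close> alone already makes
      \<open>\<Phi>\<close> tiny.\<close>
    case False
    then obtain x where x: "x \<in> ?X" "sqrt (\<Sum>i<m. (max 0 (\<kappa> - (\<Sum>l<n. w (i, l) * x l)))\<^sup>2) < r"
      and s: "w (m, n) < s" using w by (auto simp: EB_def E0_def not_le)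
    have "sqrt (\<Sum>i<m. (max 0 (\<kappa> - (\<Sum>l<n. w (i, l) * x l)))\<^sup>2) = sqrt (\<Sum>i<m. (max 0 (\<kappa> + ?B w (x, i)))\<^sup>2)"
      by (simp add: coupled_sum) (simp add: mult.commute)
    with x G_le[of "\<lambda>i. ?B w (x, i)"] have "G (\<lambda>i. ?B w (x, i)) \<le> 1 + r + \<eta> / 2 * sqrt (real m)"
      by simp
    then have "a (\<lambda>i. ?B w (x, i)) \<le> t - d" using s r unfolding a_def by (simp add: coupled_sum)
    then have "\<beta> * d \<le> \<beta> * (t - a (\<lambda>i. ?B w (x, i)))" using beta_pos by simp
    then have "exp (\<beta> * d) \<le> e (\<lambda>i. ?B w (x, i))" unfolding e_def by (simp add: algebra_simps)
    also have "\<dots> \<le> (\<Sum>x\<in>?X. e (\<lambda>i. ?B w (x, i)))"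
      using x fin e_pos by (intro member_le_sum) (auto simp: less_imp_le)
    finally have "\<Phi> ?X (?B w) \<le> exp (- exp (\<beta> * d))" by (simp add: \<Phi>_def)
    then show ?thesis by (simp add: add_increasing)
  qed
  have "measure P EA * exp (- (2 ^ n * exp (- \<beta> * d))) = (\<integral>w. indicator EA w * exp (- (2 ^ n * exp (- \<beta> * d))) \<partial>P)"
    by simp
  also have "\<dots> \<le> (\<integral>w. \<Phi> ?X (?A w) \<partial>P)"
    using lower by (intro integral_mono int) (auto simp: P.emeasure_eq_measure)
  also note cmp
  also have "(\<integral>w. \<Phi> ?X (?B w) \<partial>P) \<le> (\<integral>w. indicator EB w + indicator E0 w + exp (- exp (\<beta> * d)) \<partial>P)"
    using upper by (intro integral_mono int) (auto simp: P.emeasure_eq_measure)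
  also have "\<dots> = measure P EB + measure P E0 + exp (- exp (\<beta> * d))"
    by (simp add: P.emeasure_eq_measure P.prob_space)
  finally show ?thesis unfolding EA_def EB_def E0_def .
qed

end

subsection \<open>Moments and concentration\<close>

text \<open>Both claims are the product formula over all of \<open>I\<close>, with the constant
  factor 1 at every index other than \<open>k\<close> and \<open>l\<close>.\<close>

lemma integral_gauss_PiM_pair:
  fixes f g :: "real \<Rightarrow> real"
  assumes I: "finite I" "k \<in> I" "l \<in> I" "k \<noteq> l" and f: "integrable gauss f" and g: "integrable gauss g"
  shows "integrable (gauss_PiM I) (\<lambda>w. f (w k) * g (w l))"
    and "(\<integral>w. f (w k) * g (w l) \<partial>gauss_PiM I) = (\<integral>x. f x \<partial>gauss) * (\<integral>x. g x \<partial>gauss)"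
proof -
  define h where "h i = (if i = k then f else if i = l then g else (\<lambda>_. 1))" for i
  have h: "integrable gauss (h i)" for i using f g by (simp add: h_def)
  have I': "I = insert k (insert l (I - {k, l}))" using I by auto
  have rest: "(\<Prod>i\<in>I - {k, l}. h i (w i)) = 1" "(\<Prod>i\<in>I - {k, l}. integral\<^sup>L gauss (h i)) = 1" for w :: "'a \<Rightarrow> real"
    by (rule prod.neutral, simp add: h_def gauss.prob_space[simplified])+
  have prod: "(\<lambda>w. \<Prod>i\<in>I. h i (w i)) = (\<lambda>w. f (w k) * g (w l))"
    using I rest(1) by (subst I') (auto simp: h_def fun_eq_iff)
  show "integrable (gauss_PiM I) (\<lambda>w. f (w k) * g (w l))"
    using gauss_PiM.product_integrable_prod[OF I(1), of h] h unfolding prod .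
  have "(\<integral>w. f (w k) * g (w l) \<partial>gauss_PiM I) = (\<Prod>i\<in>I. integral\<^sup>L gauss (h i))"
    using gauss_PiM.product_integral_prod[OF I(1), of h] h unfolding prod .
  also have "\<dots> = integral\<^sup>L gauss f * integral\<^sup>L gauss g"
    using I rest(2) by (subst I') (simp add: h_def)
  finally show "(\<integral>w. f (w k) * g (w l) \<partial>gauss_PiM I) = (\<integral>x. f x \<partial>gauss) * (\<integral>x. g x \<partial>gauss)" .
qed

text \<open>In the square of the centred sum the mixed terms have mean 0 by independence, and each
  variance is at most the raw second moment. Markov's inequality for the square finishes.\<close>

lemma gauss_PiM_Chebyshev:
  fixes f :: "real \<Rightarrow> real"
  assumes I: "finite I" "J \<subseteq> I" and [measurable]: "f \<in> borel_measurable borel"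
    and f2: "integrable gauss (\<lambda>x. (f x)\<^sup>2)" and a: "0 < a"
  shows "measure (gauss_PiM I) {w \<in> space (gauss_PiM I). a \<le> \<bar>(\<Sum>k\<in>J. f (w k)) - real (card J) * (\<integral>x. f x \<partial>gauss)\<bar>}
     \<le> real (card J) * (\<integral>x. (f x)\<^sup>2 \<partial>gauss) / a\<^sup>2"
proof -
  define P where "P = gauss_PiM I"
  define \<mu> where "\<mu> = (\<integral>x. f x \<partial>gauss)"
  define g where "g x = f x - \<mu>" for x
  define S where "S w = (\<Sum>k\<in>J. g (w k))" for w
  have f_gauss: "f \<in> borel_measurable gauss" by measurable
  have J: "finite J" "\<And>k. k \<in> J \<Longrightarrow> k \<in> I" using I by (auto intro: finite_subset)
  have [measurable]: "(\<lambda>w. w k) \<in> borel_measurable P" if "k \<in> J" for k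
    unfolding P_def using J that by (intro gauss_PiM_component_measurable)
  have f: "integrable gauss f"
    using f_gauss f2 by (rule gauss.square_integrable_imp_integrable)
  have [measurable]: "g \<in> borel_measurable borel" unfolding g_def by measurable
  have g: "integrable gauss g" "(\<integral>x. g x \<partial>gauss) = 0"
    using f by (simp_all add: g_def[abs_def] \<mu>_def gauss.prob_space[simplified])
  have gg: "(\<lambda>x. (g x)\<^sup>2) = (\<lambda>x. (f x)\<^sup>2 - 2 * \<mu> * f x + \<mu>\<^sup>2)"
    by (auto simp: g_def power2_diff)
  have g2: "integrable gauss (\<lambda>x. (g x)\<^sup>2)"
    unfolding gg using f f2 by simp
  have "(\<integral>x. (g x)\<^sup>2 \<partial>gauss) = (\<integral>x. (f x)\<^sup>2 \<partial>gauss) - \<mu>\<^sup>2"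
    unfolding gg using f f2 by (simp add: gauss.prob_space[simplified] power2_eq_square flip: \<mu>_def)
  then have g2_le: "(\<integral>x. (g x)\<^sup>2 \<partial>gauss) \<le> (\<integral>x. (f x)\<^sup>2 \<partial>gauss)" by simp
  have int: "integrable P (\<lambda>w. g (w k) * g (w l))" if "k \<in> J" "l \<in> J" for k l
  proof (cases "k = l")
    case True
    then show ?thesis
      using integrable_gauss_PiM_component[OF J(2)[OF that(1)] g2] by (simp add: P_def power2_eq_square)
  next
    case False
    then show ?thesis using integral_gauss_PiM_pair(1)[OF I(1) J(2) J(2) False g(1) g(1)] that by (simp add: P_def)
  qed
  have S2: "(\<lambda>w. (S w)\<^sup>2) = (\<lambda>w. \<Sum>k\<in>J. \<Sum>l\<in>J. g (w k) * g (w l))"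
    by (simp add: S_def power2_eq_square sum_product)
  have S2_int: "integrable P (\<lambda>w. (S w)\<^sup>2)"
    unfolding S2 using int by (intro Bochner_Integration.integrable_sum) auto
  have "(\<integral>w. (S w)\<^sup>2 \<partial>P) = (\<Sum>k\<in>J. \<Sum>l\<in>J. \<integral>w. g (w k) * g (w l) \<partial>P)"
    unfolding S2 using int by (simp add: Bochner_Integration.integral_sum)
  also have "\<dots> = (\<Sum>k\<in>J. \<Sum>l\<in>J. if k = l then (\<integral>x. (g x)\<^sup>2 \<partial>gauss) else 0)"
  proof (intro sum.cong refl)
    fix k l assume kl: "k \<in> J" "l \<in> J"
    show "(\<integral>w. g (w k) * g (w l) \<partial>P) = (if k = l then (\<integral>x. (g x)\<^sup>2 \<partial>gauss) else 0)"
    proof (cases "k = l")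
      case True
      then show ?thesis
        using integral_gauss_PiM_component[OF J(2)[OF kl(1)], of "\<lambda>x. (g x)\<^sup>2"]
        by (simp add: P_def power2_eq_square)
    next
      case False
      then show ?thesis
        using integral_gauss_PiM_pair(2)[OF I(1) J(2) J(2) False g(1) g(1)] kl g(2) by (simp add: P_def)
    qed
  qed
  also have "\<dots> = real (card J) * (\<integral>x. (g x)\<^sup>2 \<partial>gauss)" using J(1) by simp
  also have "\<dots> \<le> real (card J) * (\<integral>x. (f x)\<^sup>2 \<partial>gauss)" using g2_le by (intro mult_left_mono) auto
  finally have ES: "(\<integral>w. (S w)\<^sup>2 \<partial>P) \<le> real (card J) * (\<integral>x. (f x)\<^sup>2 \<partial>gauss)" .
  have "{w \<in> space P. a \<le> \<bar>(\<Sum>k\<in>J. f (w k)) - real (card J) * \<mu>\<bar>} = {w \<in> space P. a\<^sup>2 \<le> (S w)\<^sup>2}"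
  proof -
    have "S w = (\<Sum>k\<in>J. f (w k)) - real (card J) * \<mu>" for w by (simp add: S_def g_def sum_subtractf)
    then show ?thesis using a by (simp add: abs_le_square_iff[symmetric])
  qed
  also have "measure P \<dots> \<le> (\<integral>w. (S w)\<^sup>2 \<partial>P) / a\<^sup>2"
    using a by (intro integral_Markov_inequality_measure[where A="{}"] S2_int) auto
  also have "\<dots> \<le> real (card J) * (\<integral>x. (f x)\<^sup>2 \<partial>gauss) / a\<^sup>2"
    using ES by (intro divide_right_mono) auto
  finally show ?thesis unfolding P_def \<mu>_def .
qed

section \<open>Gaussian moments and the function \<open>f_gar\<close>\<close>

lemma gauss_second_moment: "integrable gauss (\<lambda>x. x\<^sup>2)" "(\<integral>x. x\<^sup>2 \<partial>gauss) = 1"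
  using std_normal_moment_even[of 1]
  by (auto simp: integrable_gauss_iff integral_gauss has_bochner_integral_iff fact_numeral)

lemma gauss_abs_mean: "(\<integral>x. \<bar>x\<bar> \<partial>gauss) = sqrt (2 / pi)"
  using integral_std_normal_moment_abs_odd[of 0] by (simp add: integral_gauss)

text \<open>Chebyshev's inequality is applied to the squared positive part, whose second moment is
  this integral. The majorant comes from using twice that a squared sum is at most twice the sum of
  the squares.\<close>

lemma gauss_relu_fourth_moment: "integrable gauss (\<lambda>x. ((max 0 (\<kappa> + x))\<^sup>2)\<^sup>2)"
proof (rule Bochner_Integration.integrable_bound)
  show "integrable gauss (\<lambda>x. 8 * \<kappa> ^ 4 + 8 * x ^ 4)"
    using integrable_std_normal_moment[of 4] by (auto simp: integrable_gauss_iff)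
  show "AE x in gauss. norm (((max 0 (\<kappa> + x))\<^sup>2)\<^sup>2) \<le> norm (8 * \<kappa> ^ 4 + 8 * x ^ 4)"
  proof (rule AE_I2)
    fix x :: real
    have "(max 0 (\<kappa> + x))\<^sup>2 \<le> (\<kappa> + x)\<^sup>2" by (auto simp: max_def)
    also have "\<dots> \<le> 2 * (\<kappa>\<^sup>2 + x\<^sup>2)" using sum_squares_bound[of \<kappa> x] by (simp add: power2_sum)
    finally have "((max 0 (\<kappa> + x))\<^sup>2)\<^sup>2 \<le> (2 * (\<kappa>\<^sup>2 + x\<^sup>2))\<^sup>2" by (rule power_mono) simp
    also have "\<dots> = 4 * ((\<kappa>\<^sup>2)\<^sup>2 + (x\<^sup>2)\<^sup>2 + 2 * \<kappa>\<^sup>2 * x\<^sup>2)" by (simp add: power2_eq_square algebra_simps)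
    also have "\<dots> \<le> 8 * \<kappa> ^ 4 + 8 * x ^ 4"
      using sum_squares_bound[of "\<kappa>\<^sup>2" "x\<^sup>2"] by simp
    finally show "norm (((max 0 (\<kappa> + x))\<^sup>2)\<^sup>2) \<le> norm (8 * \<kappa> ^ 4 + 8 * x ^ 4)" by simp
  qed
qed auto

lemma f_gar_eq_mean: "f_gar \<kappa> = (\<integral>x. (max 0 (\<kappa> + x))\<^sup>2 \<partial>gauss)"
proof -
  have "(\<integral>x. (max 0 (\<kappa> + x))\<^sup>2 \<partial>gauss) = (\<integral>x. std_normal_density x * (max 0 (\<kappa> + x))\<^sup>2 \<partial>lborel)"
    by (rule integral_gauss) simp
  also have "\<dots> = (\<integral>x. 1 / sqrt (2 * pi) * (indicator {-\<kappa>..} x *\<^sub>R ((x + \<kappa>)\<^sup>2 * exp (- x\<^sup>2 / 2))) \<partial>lborel)"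
    by (rule Bochner_Integration.integral_cong) (auto simp: std_normal_density_def max_def add.commute split: split_indicator)
  finally show ?thesis by (simp add: f_gar_def set_lebesgue_integral_def)
qed

lemma gauss_relu_second_moment: "integrable gauss (\<lambda>x. (max 0 (\<kappa> + x))\<^sup>2)"
  by (rule gauss.square_integrable_imp_integrable) (use gauss_relu_fourth_moment in auto)

text \<open>A vanishing integral of a nonnegative function would force
  \<open>x \<le> - \<kappa>\<close> almost everywhere, but the unit interval to the right of
  \<open>- \<kappa>\<close> is not a null set.\<close>

lemma f_gar_pos: "0 < f_gar \<kappa>"
proof -
  have "0 \<le> f_gar \<kappa>" unfolding f_gar_eq_mean by (intro Bochner_Integration.integral_nonneg) auto
  moreover have "f_gar \<kappa> \<noteq> 0"
  proof
    assume "f_gar \<kappa> = 0"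
    then have "AE x in gauss. (max 0 (\<kappa> + x))\<^sup>2 = 0"
      unfolding f_gar_eq_mean using gauss_relu_second_moment by (subst (asm) integral_nonneg_eq_0_iff_AE) auto
    then have "AE x in lborel. x \<le> - \<kappa>"
      unfolding gauss_def by (subst (asm) AE_density) (auto simp: max_def std_normal_density_def split: if_splits elim!: eventually_mono)
    then have "AE x in lborel. x \<notin> {- \<kappa> <.. - \<kappa> + 1}" by (rule eventually_mono) auto
    then have "{- \<kappa> <.. - \<kappa> + 1} \<in> null_sets lborel"
      by (subst AE_iff_null_sets) auto
    then show False by (simp add: null_sets_def)
  qed
  ultimately show ?thesis by simp
qed

text \<open>By symmetry of the Gaussian, \<open>\<kappa> - x\<close> gives the same mean as
  \<open>\<kappa> + x\<close>, and one of the two is always at least \<open>\<kappa>\<close>. The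
  bound shows that \<open>f_gar\<close> can be made as large as desired.\<close>

lemma f_gar_ge: "0 \<le> \<kappa> \<Longrightarrow> \<kappa>\<^sup>2 / 2 \<le> f_gar \<kappa>"
proof -
  assume \<kappa>: "0 \<le> \<kappa>"
  have sym: "(\<integral>x. (max 0 (\<kappa> - x))\<^sup>2 \<partial>gauss) = f_gar \<kappa>"
  proof -
    have "(\<integral>x. (max 0 (\<kappa> - x))\<^sup>2 \<partial>gauss) = (\<integral>x. std_normal_density x * (max 0 (\<kappa> - x))\<^sup>2 \<partial>lborel)"
      by (rule integral_gauss) simp
    also have "\<dots> = (\<integral>x. std_normal_density x * (max 0 (\<kappa> + x))\<^sup>2 \<partial>lborel)"
      by (subst lborel_integral_real_affine[where t=0 and c="-1"]) (simp_all add: std_normal_density_def)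
    finally show ?thesis by (simp add: f_gar_eq_mean integral_gauss)
  qed
  have int: "integrable gauss (\<lambda>x. (max 0 (\<kappa> - x))\<^sup>2)"
  proof (rule Bochner_Integration.integrable_bound)
    show "integrable gauss (\<lambda>x. 2 * (\<kappa>\<^sup>2 + x\<^sup>2))" using gauss_second_moment(1) by auto
    show "AE x in gauss. norm ((max 0 (\<kappa> - x))\<^sup>2) \<le> norm (2 * (\<kappa>\<^sup>2 + x\<^sup>2))"
    proof (rule AE_I2)
      fix x :: real
      have "(max 0 (\<kappa> - x))\<^sup>2 \<le> (\<kappa> - x)\<^sup>2" by (auto simp: max_def)
      also have "\<dots> \<le> 2 * (\<kappa>\<^sup>2 + x\<^sup>2)" using sum_squares_bound[of \<kappa> "-x"] by (simp add: power2_diff)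
      finally show "norm ((max 0 (\<kappa> - x))\<^sup>2) \<le> norm (2 * (\<kappa>\<^sup>2 + x\<^sup>2))" by simp
    qed
  qed auto
  have "\<kappa>\<^sup>2 = (\<integral>x. \<kappa>\<^sup>2 \<partial>gauss)" by (simp add: gauss.prob_space[simplified])
  also have "\<dots> \<le> (\<integral>x. (max 0 (\<kappa> + x))\<^sup>2 + (max 0 (\<kappa> - x))\<^sup>2 \<partial>gauss)"
  proof (rule integral_mono)
    fix x :: real
    show "\<kappa>\<^sup>2 \<le> (max 0 (\<kappa> + x))\<^sup>2 + (max 0 (\<kappa> - x))\<^sup>2"
    proof (cases "0 \<le> x")
      case True
      then have "\<kappa>\<^sup>2 \<le> (max 0 (\<kappa> + x))\<^sup>2" using \<kappa> by (intro power_mono) auto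
      then show ?thesis by (simp add: add_increasing2)
    next
      case False
      then have "\<kappa>\<^sup>2 \<le> (max 0 (\<kappa> - x))\<^sup>2" using \<kappa> by (intro power_mono) auto
      then show ?thesis by (simp add: add_increasing)
    qed
  qed (use int gauss_relu_second_moment in auto)
  also have "\<dots> = 2 * f_gar \<kappa>"
    using int gauss_relu_second_moment by (simp add: sym flip: f_gar_eq_mean)
  finally show ?thesis by simp
qed

text \<open>The square \<open>(z + \<kappa>)\<^sup>2\<close> splits into
  \<open>z\<^sup>2 + 2 * \<kappa> * z - 1\<close> and the constant
  \<open>\<kappa>\<^sup>2 + 1\<close>. Times the exponential, the first part has the elementary
  antiderivative \<open>F\<close>; the second becomes \<open>erfc\<close> after rescaling by the
  root of 2.\<close>

lemma f_gar_closed_form: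
  "f_gar \<kappa> = \<kappa> * exp (- \<kappa>\<^sup>2 / 2) / sqrt (2 * pi) + (\<kappa>\<^sup>2 + 1) * erfc (- \<kappa> / sqrt 2) / 2"
proof -
  define N where "N = (LBINT z:{-\<kappa>..}. exp (- z\<^sup>2 / 2))"
  have poly: "set_integrable lborel {-\<kappa>..} (\<lambda>z. z ^ k * exp (- z\<^sup>2 / 2))" for k
  proof -
    have "integrable lborel (\<lambda>x. sqrt (2 * pi) * (std_normal_density x * x ^ k))"
      using integrable_std_normal_moment[of k] by simp
    also have "(\<lambda>x. sqrt (2 * pi) * (std_normal_density x * x ^ k)) = (\<lambda>z. z ^ k * exp (- z\<^sup>2 / 2))"
      by (auto simp: std_normal_density_def)
    finally show ?thesis unfolding set_integrable_def by (intro integrable_mult_indicator) auto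
  qed
  have i0: "set_integrable lborel {-\<kappa>..} (\<lambda>z. exp (- z\<^sup>2 / 2))" using poly[of 0] by simp
  define F where "F z = - ((z + 2 * \<kappa>) * exp (- z\<^sup>2 / 2))" for z :: real
  define f where "f z = (z\<^sup>2 + 2 * \<kappa> * z - 1) * exp (- z\<^sup>2 / 2)" for z :: real
  have f_int: "set_integrable lborel {-\<kappa>..} f"
  proof -
    have "set_integrable lborel {-\<kappa>..} (\<lambda>z. z ^ 2 * exp (- z\<^sup>2 / 2) + 2 * \<kappa> * (z ^ 1 * exp (- z\<^sup>2 / 2)) - z ^ 0 * exp (- z\<^sup>2 / 2))"
      by (intro set_integral_add set_integral_diff set_integrable_mult_right poly)
    then show ?thesis unfolding f_def by (simp add: algebra_simps)
  qed
  have DF: "(F has_real_derivative f z) (at z)" for z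
    unfolding F_def f_def by (auto intro!: derivative_eq_intros simp: algebra_simps power2_eq_square)
  have "(LBINT z:{-\<kappa>..}. f z) = (LBINT z=ereal (- \<kappa>)..\<infinity>. f z)"
    unfolding interval_integral_to_infinity_eq
  proof (rule set_integral_cong_set)
    show "AE x in lborel. x \<in> {-\<kappa><..} \<longleftrightarrow> x \<in> {-\<kappa>..}"
      using AE_lborel_singleton[of "- \<kappa>"] by eventually_elim auto
  qed (auto simp: set_borel_measurable_def f_def)
  also have "\<dots> = 0 - F (- \<kappa>)"
  proof (rule interval_integral_FTC_integrable)
    show "set_integrable lborel (einterval (ereal (- \<kappa>)) \<infinity>) f"
      using f_int by (rule set_integrable_subset) (auto simp: einterval_def)
    show "(F has_vector_derivative f x) (at x)" for x
      using DF[of x] by (simp add: has_real_derivative_iff_has_vector_derivative)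
    show "isCont f x" for x unfolding f_def by (intro continuous_intros) auto
    have "(F \<longlongrightarrow> F (- \<kappa>)) (at_right (- \<kappa>))"
      using DERIV_isCont[OF DF[of "- \<kappa>"]] by (auto simp: isCont_def intro: tendsto_within_subset)
    then show "((F \<circ> real_of_ereal) \<longlongrightarrow> F (- \<kappa>)) (at_right (ereal (- \<kappa>)))"
      by (simp add: ereal_tendsto_simps)
    have "(F \<longlongrightarrow> 0) at_top" unfolding F_def by real_asymp
    then show "((F \<circ> real_of_ereal) \<longlongrightarrow> 0) (at_left \<infinity>)" by (simp add: ereal_tendsto_simps)
  qed simp
  also have "\<dots> = \<kappa> * exp (- \<kappa>\<^sup>2 / 2)" by (simp add: F_def)
  finally have f_val: "(LBINT z:{-\<kappa>..}. f z) = \<kappa> * exp (- \<kappa>\<^sup>2 / 2)" .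
  have "(LBINT z:{-\<kappa>..}. (z + \<kappa>)\<^sup>2 * exp (- z\<^sup>2 / 2)) = (LBINT z:{-\<kappa>..}. f z + (\<kappa>\<^sup>2 + 1) * exp (- z\<^sup>2 / 2))"
    by (intro set_lebesgue_integral_cong) (auto simp: f_def power2_eq_square algebra_simps)
  also have "\<dots> = \<kappa> * exp (- \<kappa>\<^sup>2 / 2) + (\<kappa>\<^sup>2 + 1) * N"
    using f_int i0 f_val unfolding N_def by (subst set_integral_add) auto
  finally have fg: "f_gar \<kappa> = (\<kappa> * exp (- \<kappa>\<^sup>2 / 2) + (\<kappa>\<^sup>2 + 1) * N) / sqrt (2 * pi)"
    by (simp add: f_gar_def)
  have "(LBINT t:{- \<kappa> / sqrt 2..}. exp (- t\<^sup>2)) = (1 / sqrt 2) * N"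
  proof -
    have "(LBINT t:{- \<kappa> / sqrt 2..}. exp (- t\<^sup>2))
      = \<bar>1 / sqrt 2\<bar> *\<^sub>R (\<integral>x. indicator {- \<kappa> / sqrt 2..} (0 + 1 / sqrt 2 * x) *\<^sub>R exp (- (0 + 1 / sqrt 2 * x)\<^sup>2) \<partial>lborel)"
      unfolding set_lebesgue_integral_def by (rule lborel_integral_real_affine) simp
    also have "(\<lambda>x. indicator {- \<kappa> / sqrt 2..} (0 + 1 / sqrt 2 * x) *\<^sub>R exp (- (0 + 1 / sqrt 2 * x)\<^sup>2))
      = (\<lambda>x. indicator {- \<kappa>..} x *\<^sub>R exp (- x\<^sup>2 / 2))"
      by (auto simp: indicator_def power_divide field_simps fun_eq_iff)
    finally show ?thesis by (simp add: N_def set_lebesgue_integral_def)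
  qed
  then have "erfc (- \<kappa> / sqrt 2) = 2 * N / (sqrt pi * sqrt 2)" by (simp add: erfc_def)
  then show ?thesis unfolding fg by (simp add: real_sqrt_mult field_simps)
qed

subsection \<open>The inner maximum and the limit\<close>

text \<open>If some \<open>w i\<close> is positive, Cauchy-Schwarz bounds the form by the norm of
  the positive part, attained at its normalisation. Otherwise the maximum is the largest entry,
  attained at a unit vector.\<close>

lemma SUP_nonneg_sphere_ge_iff:
  fixes w :: "nat \<Rightarrow> real"
  assumes m: "0 < m"
  shows "t \<le> (SUP l\<in>nonneg_sphere m. \<Sum>i<m. l i * w i) \<longleftrightarrow>
    (if \<exists>i<m. 0 < w i then t \<le> sqrt (\<Sum>i<m. (max 0 (w i))\<^sup>2) else \<exists>i<m. t \<le> w i)"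
proof -
  define N where "N = sqrt (\<Sum>i<m. (max 0 (w i))\<^sup>2)"
  let ?f = "\<lambda>l. \<Sum>i<m. l i * w i"
  have sphere: "(\<Sum>i<m. (l i)\<^sup>2) = 1" "\<And>i. i < m \<Longrightarrow> 0 \<le> l i" if "l \<in> nonneg_sphere m" for l
    using that by (auto simp: nonneg_sphere_def)
  show ?thesis
  proof (cases "\<exists>i<m. 0 < w i")
    case True
    then obtain i where i: "i < m" "0 < w i" by blast
    have "0 < (\<Sum>i<m. (max 0 (w i))\<^sup>2)"
      using i by (intro sum_pos2[where i=i]) auto
    then have N: "0 < N" "N\<^sup>2 = (\<Sum>i<m. (max 0 (w i))\<^sup>2)" by (simp_all add: N_def)
    define l0 where "l0 = restrict (\<lambda>i. max 0 (w i) / N) {..<m}"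
    have "(\<Sum>i<m. (l0 i)\<^sup>2) = (\<Sum>i<m. (max 0 (w i))\<^sup>2) / N\<^sup>2"
      by (simp add: l0_def power_divide sum_divide_distrib)
    also have "\<dots> = 1" using N(1) unfolding N(2)[symmetric] by simp
    finally have "l0 \<in> nonneg_sphere m"
      using N by (auto simp: nonneg_sphere_def l0_def)
    moreover have "?f l0 = N"
    proof -
      have "?f l0 = (\<Sum>i<m. (max 0 (w i))\<^sup>2 / N)"
        by (intro sum.cong) (auto simp: l0_def max_def power2_eq_square)
      also have "\<dots> = N\<^sup>2 / N" unfolding N(2) by (rule sum_divide_distrib[symmetric])
      also have "\<dots> = N" by (simp add: power2_eq_square)
      finally show ?thesis .
    qed
    moreover have "?f l \<le> N" if l: "l \<in> nonneg_sphere m" for l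
    proof -
      have "?f l \<le> (\<Sum>i<m. \<bar>l i\<bar> * \<bar>max 0 (w i)\<bar>)"
        using sphere[OF l] by (intro sum_mono) (auto intro: mult_left_mono)
      also have "\<dots> \<le> L2_set l {..<m} * L2_set (\<lambda>i. max 0 (w i)) {..<m}" by (rule L2_set_mult_ineq)
      finally show ?thesis using sphere[OF l] by (simp add: L2_set_def N_def)
    qed
    ultimately have "(SUP l\<in>nonneg_sphere m. ?f l) = N"
      by (intro cSup_eq_maximum) auto
    then show ?thesis using True by (simp add: N_def)
  next
    case False
    then have neg: "\<And>i. i < m \<Longrightarrow> w i \<le> 0" by (meson not_le)
    define W where "W = Max (w ` {..<m})"
    have W: "W \<in> w ` {..<m}" "\<And>i. i < m \<Longrightarrow> w i \<le> W"
      unfolding W_def using m by (intro Max_in Max_ge; auto)+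
    then obtain i0 where i0: "i0 < m" "w i0 = W" by auto
    define l0 where "l0 = restrict (\<lambda>i. of_bool (i = i0) :: real) {..<m}"
    have "(\<Sum>i<m. (l0 i)\<^sup>2) = (\<Sum>i<m. of_bool (i = i0))"
      by (intro sum.cong) (auto simp: l0_def)
    then have "l0 \<in> nonneg_sphere m"
      using i0 by (auto simp: nonneg_sphere_def l0_def)
    moreover have "?f l0 = W"
    proof -
      have "?f l0 = (\<Sum>i<m. if i = i0 then w i else 0)" by (intro sum.cong) (auto simp: l0_def)
      then show ?thesis using i0 by simp
    qed
    moreover have "?f l \<le> W" if l: "l \<in> nonneg_sphere m" for l
    proof -
      have le1: "l i \<le> 1" if "i < m" for i
      proof -
        have "(l i)\<^sup>2 \<le> (\<Sum>i<m. (l i)\<^sup>2)" using that by (intro member_le_sum) auto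
        then have "(l i)\<^sup>2 \<le> 1\<^sup>2" using sphere[OF l] by simp
        then show ?thesis by (rule power2_le_imp_le) simp
      qed
      \<comment> \<open>Entries in the unit interval dominate their squares, so the total weight is
        at least 1. As \<open>W \<le> 0\<close>, extra weight only lowers the value.\<close>
      have "1 = (\<Sum>i<m. (l i)\<^sup>2)" using sphere[OF l] by simp
      also have "\<dots> \<le> (\<Sum>i<m. l i)"
        using sphere[OF l] le1 by (intro sum_mono) (auto simp: power2_eq_square mult_left_le)
      finally have "1 \<le> (\<Sum>i<m. l i)" .
      moreover have "W \<le> 0" using i0 neg by auto
      ultimately have "(\<Sum>i<m. l i) * W \<le> W" using mult_right_mono_neg by fastforce
      moreover have "?f l \<le> (\<Sum>i<m. l i * W)"
        using sphere[OF l] W(2) by (intro sum_mono mult_left_mono) auto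
      ultimately show ?thesis by (simp add: sum_distrib_right)
    qed
    ultimately have "(SUP l\<in>nonneg_sphere m. ?f l) = W"
      by (intro cSup_eq_maximum) auto
    moreover have "t \<le> W \<longleftrightarrow> (\<exists>i<m. t \<le> w i)"
      unfolding W_def using m by (subst Max_ge_iff) auto
    ultimately show ?thesis unfolding if_not_P[OF False] by simp
  qed
qed

lemma cube_pm1_nonempty: "cube_pm1 n \<noteq> {}"
proof -
  have "restrict (\<lambda>i. 1 / sqrt (real n)) {..<n} \<in> cube_pm1 n"
    by (auto simp: cube_pm1_def power_divide)
  then show ?thesis by blast
qed

text \<open>The form is the inner product of \<open>l\<close> with the vector of the margins. The
  event becomes a finite combination of inequalities, which serves both for its measurability and
  for the event inclusions in \<open>theorem6\<close>.\<close>

lemma xi_pm1_ge_iff: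
  assumes "0 < m"
  shows "t \<le> xi_pm1 \<kappa> m n A \<longleftrightarrow> (\<forall>x\<in>cube_pm1 n.
    if \<exists>i<m. 0 < \<kappa> - (\<Sum>l<n. A i l * x l)
    then t \<le> sqrt (\<Sum>i<m. (max 0 (\<kappa> - (\<Sum>l<n. A i l * x l)))\<^sup>2)
    else \<exists>i<m. t \<le> \<kappa> - (\<Sum>l<n. A i l * x l))"
proof -
  have "\<kappa> * (\<Sum>i<m. l i) - (\<Sum>i<m. l i * (\<Sum>j<n. A i j * x j)) = (\<Sum>i<m. l i * (\<kappa> - (\<Sum>j<n. A i j * x j)))"
    for l x :: "nat \<Rightarrow> real"
    by (simp add: right_diff_distrib sum_subtractf sum_distrib_left mult.commute)
  then show ?thesis
    unfolding xi_pm1_def using finite_cube_pm1[of n] cube_pm1_nonempty[of n]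
    by (simp add: SUP_nonneg_sphere_ge_iff[OF assms])
qed

section \<open>From the random matrix to the product Gaussian space\<close>

lemma std_normal_matrix_measurable:
  assumes "std_normal_matrix M m n H" "i < m" "j < n"
  shows "H i j \<in> borel_measurable M"
  using assms distributed_measurable[of M lborel "H i j"] by (auto simp: std_normal_matrix_def)

text \<open>Independence means that the joint law is the product of the marginal laws, and each of
  these is \<open>gauss\<close>. Positive dimensions make the index set nonempty, as that
  characterisation requires.\<close>

lemma std_normal_matrix_distr:
  assumes H: "std_normal_matrix M m n H" and "0 < m" "0 < n"
  defines "J \<equiv> {..<m} \<times> {..<n}"
  shows "distr M (gauss_PiM J) (\<lambda>\<omega>. \<lambda>(i, j)\<in>J. H i j \<omega>) = gauss_PiM J"
proof -
  interpret prob_space M using H by (simp add: std_normal_matrix_def)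
  have rv: "random_variable borel (case k of (i, j) \<Rightarrow> H i j)" if "k \<in> J" for k
    using that std_normal_matrix_measurable[OF H] by (auto simp: J_def)
  have "distr M (Pi\<^sub>M J (\<lambda>_. borel)) (\<lambda>\<omega>. \<lambda>k\<in>J. (case k of (i, j) \<Rightarrow> H i j) \<omega>)
    = (\<Pi>\<^sub>M k\<in>J. distr M borel (case k of (i, j) \<Rightarrow> H i j))"
    using indep_vars_iff_distr_eq_PiM'[where I=J and M'="\<lambda>_. borel" and X="\<lambda>(i, j). H i j"] rv H assms(2,3)
    by (auto simp: std_normal_matrix_def J_def)
  also have "\<dots> = gauss_PiM J"
  proof (rule PiM_cong[OF refl])
    fix k assume "k \<in> J"
    then have "distributed M lborel (case k of (i, j) \<Rightarrow> H i j) std_normal_density"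
      using H by (auto simp: std_normal_matrix_def J_def)
    then have "distr M lborel (case k of (i, j) \<Rightarrow> H i j) = gauss"
      by (simp add: gauss_def distributed_distr_eq_density)
    then show "distr M borel (case k of (i, j) \<Rightarrow> H i j) = gauss"
      by (simp cong: distr_cong)
  qed
  finally have eq: "distr M (Pi\<^sub>M J (\<lambda>_. borel)) (\<lambda>\<omega>. \<lambda>k\<in>J. (case k of (i, j) \<Rightarrow> H i j) \<omega>) = gauss_PiM J" .
  have "distr M (gauss_PiM J) (\<lambda>\<omega>. \<lambda>(i, j)\<in>J. H i j \<omega>) = distr M (Pi\<^sub>M J (\<lambda>_. borel)) (\<lambda>\<omega>. \<lambda>k\<in>J. (case k of (i, j) \<Rightarrow> H i j) \<omega>)"
    by (rule distr_cong) (auto intro!: sets_PiM_cong simp: restrict_def split_beta')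
  with eq show ?thesis by simp
qed

text \<open>The event reads only the entries in \<open>J\<close>. On them the matrix and the larger
  Gaussian space have the same law, the latter by restriction of a product measure.\<close>

lemma std_normal_matrix_prob_transfer:
  assumes H: "std_normal_matrix M m n H" and mn: "0 < m" "0 < n"
  defines "P \<equiv> gauss_PiM ({..m} \<times> {..n})"
  shows "measure M {\<omega> \<in> space M. \<forall>x\<in>cube_pm1 n. r \<le> sqrt (\<Sum>i<m. (max 0 (\<kappa> - (\<Sum>l<n. H i l \<omega> * x l)))\<^sup>2)}
    = measure P {w \<in> space P. \<forall>x\<in>cube_pm1 n. r \<le> sqrt (\<Sum>i<m. (max 0 (\<kappa> - (\<Sum>l<n. w (i, l) * x l)))\<^sup>2)}"
proof -
  define J where "J = {..<m} \<times> {..<n}"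
  define Q where "Q v \<longleftrightarrow> (\<forall>x\<in>cube_pm1 n. r \<le> sqrt (\<Sum>i<m. (max 0 (\<kappa> - (\<Sum>l<n. v (i, l) * x l)))\<^sup>2))" for v :: "nat \<times> nat \<Rightarrow> real"
  have comp [measurable]: "(\<lambda>w. w (i, l)) \<in> borel_measurable (gauss_PiM J)" if "i < m" "l < n" for i l
    using that by (intro gauss_PiM_component_measurable) (auto simp: J_def)
  have Qs: "{v \<in> space (gauss_PiM J). Q v} \<in> sets (gauss_PiM J)"
    unfolding Q_def using finite_cube_pm1 by (intro sets.sets_Collect_finite_All) (measurable; simp)+
  have m1: "(\<lambda>\<omega>. \<lambda>(i, j)\<in>J. H i j \<omega>) \<in> measurable M (gauss_PiM J)"
    using std_normal_matrix_measurable[OF H]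
    by (intro measurable_restrict) (auto simp: J_def cong: measurable_cong_sets)
  have "measure M {\<omega> \<in> space M. Q (\<lambda>(i, j). H i j \<omega>)} = measure M ((\<lambda>\<omega>. \<lambda>(i, j)\<in>J. H i j \<omega>) -` {v \<in> space (gauss_PiM J). Q v} \<inter> space M)"
    using measurable_space[OF m1] by (intro arg_cong[where f="measure M"]) (auto simp: Q_def J_def)
  also have "\<dots> = measure (distr M (gauss_PiM J) (\<lambda>\<omega>. \<lambda>(i, j)\<in>J. H i j \<omega>)) {v \<in> space (gauss_PiM J). Q v}"
    by (rule measure_distr[OF m1 Qs, symmetric])
  also have "\<dots> = measure (gauss_PiM J) {v \<in> space (gauss_PiM J). Q v}"
    using std_normal_matrix_distr[OF H mn] by (simp add: J_def)
  also have "\<dots> = measure (distr P (gauss_PiM J) (\<lambda>w. restrict w J)) {v \<in> space (gauss_PiM J). Q v}"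
    unfolding P_def by (subst gauss_PiM.distr_restrict[of J "{..m} \<times> {..n}"]) (auto simp: J_def)
  also have "\<dots> = measure P ((\<lambda>w. restrict w J) -` {v \<in> space (gauss_PiM J). Q v} \<inter> space P)"
    by (rule measure_distr[OF _ Qs]) (auto simp: P_def J_def intro!: measurable_restrict_subset)
  also have "\<dots> = measure P {w \<in> space P. Q w}"
    by (intro arg_cong[where f="measure P"]) (auto simp: Q_def P_def J_def space_PiM)
  finally show ?thesis by (simp add: Q_def)
qed

section \<open>Concentration of the decoupled family and the limit\<close>

text \<open>Chebyshev's inequality is used twice, for the squared positive parts in the last column
  and for the absolute values in the last row. Off the two exceptional events \<open>B1\<close> and
  \<open>B2\<close> the hypothesis \<open>T\<close> gives the bound directly.\<close>

lemma decoupled_prob_ge: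
  fixes \<kappa> \<delta>1 \<delta>2 T :: real and m n :: nat
  assumes mn: "0 < m" "0 < n" and \<delta>: "0 < \<delta>1" "0 < \<delta>2"
    and T: "T + sqrt (real n) * (sqrt (2 / pi) + \<delta>2) \<le> sqrt (real m * (f_gar \<kappa> - \<delta>1))"
  defines "P \<equiv> gauss_PiM ({..m} \<times> {..n})"
  shows "1 - (\<integral>x. ((max 0 (\<kappa> + x))\<^sup>2)\<^sup>2 \<partial>gauss) / (real m * \<delta>1\<^sup>2) - 1 / (real n * \<delta>2\<^sup>2)
    \<le> measure P {w \<in> space P. T \<le> sqrt (\<Sum>i<m. (max 0 (\<kappa> + w (i, n)))\<^sup>2) - (\<Sum>l<n. \<bar>w (m, l)\<bar>) / sqrt (real n)}"
proof -
  define V where "V = (\<integral>x. ((max 0 (\<kappa> + x))\<^sup>2)\<^sup>2 \<partial>gauss)"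
  interpret P: prob_space P unfolding P_def by (rule gauss_PiM.P.prob_space_axioms)
  have comp [measurable]: "(\<lambda>w. w (i, l)) \<in> borel_measurable P" if "i \<le> m" "l \<le> n" for i l
    using that unfolding P_def by (intro gauss_PiM_component_measurable) auto
  define E where "E = {w \<in> space P. T \<le> sqrt (\<Sum>i<m. (max 0 (\<kappa> + w (i, n)))\<^sup>2) - (\<Sum>l<n. \<bar>w (m, l)\<bar>) / sqrt (real n)}"
  define B1 where "B1 = {w \<in> space P. real m * \<delta>1 \<le> \<bar>(\<Sum>i<m. (max 0 (\<kappa> + w (i, n)))\<^sup>2) - real m * f_gar \<kappa>\<bar>}"
  define B2 where "B2 = {w \<in> space P. real n * \<delta>2 \<le> \<bar>(\<Sum>l<n. \<bar>w (m, l)\<bar>) - real n * sqrt (2 / pi)\<bar>}"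
  have [measurable]: "E \<in> sets P" "B1 \<in> sets P" "B2 \<in> sets P"
    unfolding E_def B1_def B2_def by (measurable; simp)+
  have inj: "inj_on (\<lambda>i. (i, n)) {..<m}" "inj_on (\<lambda>l. (m, l)) {..<n}" by (auto intro: inj_onI)
  have sub: "(\<lambda>i. (i, n)) ` {..<m} \<subseteq> {..m} \<times> {..n}" "(\<lambda>l. (m, l)) ` {..<n} \<subseteq> {..m} \<times> {..n}"
    by auto
  have "measure P B1 \<le> real m * V / (real m * \<delta>1)\<^sup>2"
    using gauss_PiM_Chebyshev[of "{..m} \<times> {..n}" "(\<lambda>i. (i, n)) ` {..<m}" "\<lambda>x. (max 0 (\<kappa> + x))\<^sup>2" "real m * \<delta>1"]
      inj(1) sub(1) mn \<delta> gauss_relu_fourth_moment[of \<kappa>]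
    by (auto simp: B1_def P_def V_def f_gar_eq_mean sum.reindex card_image)
  also have "\<dots> = V / (real m * \<delta>1\<^sup>2)" using mn by (simp add: power2_eq_square)
  finally have B1: "measure P B1 \<le> V / (real m * \<delta>1\<^sup>2)" .
  have "measure P B2 \<le> real n * 1 / (real n * \<delta>2)\<^sup>2"
    using gauss_PiM_Chebyshev[of "{..m} \<times> {..n}" "(\<lambda>l. (m, l)) ` {..<n}" abs "real n * \<delta>2"]
      inj(2) sub(2) mn \<delta> gauss_second_moment gauss_abs_mean
    by (auto simp: B2_def P_def sum.reindex card_image)
  also have "\<dots> = 1 / (real n * \<delta>2\<^sup>2)" using mn by (simp add: power2_eq_square)
  finally have B2: "measure P B2 \<le> 1 / (real n * \<delta>2\<^sup>2)" .
  have "w \<in> E \<union> (B1 \<union> B2)" if w: "w \<in> space P" for w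
  proof (rule ccontr)
    assume "w \<notin> E \<union> (B1 \<union> B2)"
    then have nE: "w \<notin> E" and 1: "\<bar>(\<Sum>i<m. (max 0 (\<kappa> + w (i, n)))\<^sup>2) - real m * f_gar \<kappa>\<bar> < real m * \<delta>1"
      and 2: "\<bar>(\<Sum>l<n. \<bar>w (m, l)\<bar>) - real n * sqrt (2 / pi)\<bar> < real n * \<delta>2"
      using w by (auto simp: B1_def B2_def)
    have "real m * (f_gar \<kappa> - \<delta>1) \<le> (\<Sum>i<m. (max 0 (\<kappa> + w (i, n)))\<^sup>2)"
      using 1 by (simp add: algebra_simps abs_less_iff)
    then have "sqrt (real m * (f_gar \<kappa> - \<delta>1)) \<le> sqrt (\<Sum>i<m. (max 0 (\<kappa> + w (i, n)))\<^sup>2)"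
      by (rule real_sqrt_le_mono)
    moreover have "(\<Sum>l<n. \<bar>w (m, l)\<bar>) / sqrt (real n) \<le> sqrt (real n) * (sqrt (2 / pi) + \<delta>2)"
    proof -
      have "(\<Sum>l<n. \<bar>w (m, l)\<bar>) \<le> real n * (sqrt (2 / pi) + \<delta>2)"
        using 2 by (simp add: algebra_simps abs_less_iff)
      also have "\<dots> = sqrt (real n) * (sqrt (2 / pi) + \<delta>2) * sqrt (real n)"
        using real_sqrt_mult_self[of "real n"] by (simp add: mult_ac del: real_sqrt_mult_self)
      finally show ?thesis using mn by (simp add: pos_divide_le_eq)
    qed
    ultimately have "T \<le> sqrt (\<Sum>i<m. (max 0 (\<kappa> + w (i, n)))\<^sup>2) - (\<Sum>l<n. \<bar>w (m, l)\<bar>) / sqrt (real n)"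
      using T by linarith
    then have "w \<in> E" using w by (simp add: E_def)
    with nE show False ..
  qed
  then have "measure P (space P) \<le> measure P (E \<union> (B1 \<union> B2))"
    by (intro P.finite_measure_mono) auto
  also have "\<dots> \<le> measure P E + (measure P B1 + measure P B2)"
    by (intro order.trans[OF measure_Un_le] add_left_mono measure_Un_le) auto
  finally show ?thesis using B1 B2 unfolding E_def V_def P.prob_space by simp
qed

lemma corner_prob_le:
  fixes s :: real and m n :: nat
  assumes s: "0 < s"
  defines "P \<equiv> gauss_PiM ({..m} \<times> {..n})"
  shows "measure P {w \<in> space P. s \<le> w (m, n)} \<le> 1 / s\<^sup>2"
proof -
  interpret P: prob_space P unfolding P_def by (rule gauss_PiM.P.prob_space_axioms)
  have [measurable]: "(\<lambda>w. w (m, n)) \<in> borel_measurable P"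
    unfolding P_def by (intro gauss_PiM_component_measurable) auto
  have "(\<integral>x. x \<partial>gauss) = 0"
    using integral_std_normal_moment_odd[of 0] by (simp add: integral_gauss)
  then have "measure P {w \<in> space P. s \<le> \<bar>w (m, n)\<bar>} \<le> 1 / s\<^sup>2"
    using gauss_PiM_Chebyshev[of "{..m} \<times> {..n}" "{(m, n)}" "\<lambda>x. x" s] s gauss_second_moment
    by (simp add: P_def)
  moreover have "measure P {w \<in> space P. s \<le> w (m, n)} \<le> measure P {w \<in> space P. s \<le> \<bar>w (m, n)\<bar>}"
    by (intro P.finite_measure_mono) auto
  ultimately show ?thesis by simp
qed

text \<open>The asymptotic form of \<open>gordon_prob_bound\<close>, with \<open>\<beta> = n\<close>
  and all slacks proportional to the root of \<open>n\<close>. The scalar corner and the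
  fluctuations are then negligible.\<close>

theorem margin_prob_tendsto_1:
  fixes \<alpha> \<kappa> c :: real and m :: "nat \<Rightarrow> nat" and M :: "nat \<Rightarrow> 'a measure"
  assumes \<alpha>: "0 < \<alpha>" and m: "\<And>n. \<bar>real (m n) - \<alpha> * real n\<bar> < 1"
    and H: "\<And>n. std_normal_matrix (M n) (m n) n (H n)"
    and c: "c < sqrt (\<alpha> * f_gar \<kappa>) - sqrt (2 / pi)"
  shows "(\<lambda>n. measure (M n) {\<omega> \<in> space (M n). \<forall>x\<in>cube_pm1 n.
      c * sqrt (real n) \<le> sqrt (\<Sum>i<m n. (max 0 (\<kappa> - (\<Sum>l<n. H n i l \<omega> * x l)))\<^sup>2)}) \<longlonglongrightarrow> 1"
proof -
  define f where "f = f_gar \<kappa>"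
  \<comment> \<open>One unit each covers the smoothing, the constant 1, the scalar, the gaps below
    and above \<open>t\<close>, the loss from \<open>\<delta>1\<close>, and the fluctuation of the
    1-norm. The eighth unit is spare.\<close>
  define \<delta> where "\<delta> = (sqrt (\<alpha> * f) - sqrt (2 / pi) - c) / 8"
  have \<delta>: "0 < \<delta>" using c by (simp add: \<delta>_def f_def)
  have f: "0 < f" unfolding f_def by (rule f_gar_pos)
  obtain \<delta>1 where \<delta>1: "0 < \<delta>1" "sqrt (\<alpha> * f) - \<delta> < sqrt (\<alpha> * (f - \<delta>1))"
  proof -
    have "((\<lambda>d. sqrt (\<alpha> * (f - d))) \<longlongrightarrow> sqrt (\<alpha> * (f - 0))) (at_right 0)"
      by (intro tendsto_intros)
    then have "eventually (\<lambda>d. sqrt (\<alpha> * f) - \<delta> < sqrt (\<alpha> * (f - d))) (at_right 0)"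
      using \<delta> by (intro order_tendstoD(1)) auto
    then have "eventually (\<lambda>d. 0 < d \<and> sqrt (\<alpha> * f) - \<delta> < sqrt (\<alpha> * (f - d))) (at_right 0)"
      using eventually_at_right_less by eventually_elim auto
    then show thesis using that eventually_happens'[OF trivial_limit_at_right_real] by blast
  qed
  \<comment> \<open>Since eventually \<open>m n \<le> (\<alpha> + 1) * n\<close>, the smoothing
    error \<open>\<eta> / 2 * sqrt (m n)\<close> is at most one unit
    \<open>\<delta> * sqrt n\<close>.\<close>
  define \<eta> where "\<eta> = 2 * \<delta> / sqrt (\<alpha> + 1)"
  have \<eta>: "0 < \<eta>" using \<delta> \<alpha> by (simp add: \<eta>_def)
  define V where "V = (\<integral>x. ((max 0 (\<kappa> + x))\<^sup>2)\<^sup>2 \<partial>gauss)"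
  define good where "good n = measure (M n) {\<omega> \<in> space (M n). \<forall>x\<in>cube_pm1 n.
      c * sqrt (real n) \<le> sqrt (\<Sum>i<m n. (max 0 (\<kappa> - (\<Sum>l<n. H n i l \<omega> * x l)))\<^sup>2)}" for n
  \<comment> \<open>The bound from \<open>gordon_prob_bound\<close> solved for the wanted
    probability. It tends to 1 because the exponent \<open>n * \<delta> * sqrt n\<close> outgrows
    the \<open>n * ln 2\<close> from the number of vertices.\<close>
  define L where "L n = (1 - V / (real (m n) * \<delta>1\<^sup>2) - 1 / (real n * \<delta>\<^sup>2))
      * exp (- (2 ^ n * exp (- real n * (\<delta> * sqrt (real n)))))
      - 1 / (\<delta> * sqrt (real n))\<^sup>2 - exp (- exp (real n * (\<delta> * sqrt (real n))))" for n
  have m_top: "filterlim (\<lambda>n. real (m n)) at_top sequentially"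
  proof (rule filterlim_at_top_mono)
    show "filterlim (\<lambda>n. \<alpha> * real n - 1) at_top sequentially" using \<alpha> by real_asymp
    show "eventually (\<lambda>n. \<alpha> * real n - 1 \<le> real (m n)) sequentially"
      using m by (intro always_eventually) (smt (verit))
  qed
  have m_ratio: "(\<lambda>n. real (m n) / real n) \<longlonglongrightarrow> \<alpha>"
  proof (rule tendsto_sandwich)
    show "eventually (\<lambda>n. \<alpha> - 1 / real n \<le> real (m n) / real n) sequentially"
      "eventually (\<lambda>n. real (m n) / real n \<le> \<alpha> + 1 / real n) sequentially"
    proof -
      have "\<alpha> - 1 / real n \<le> real (m n) / real n \<and> real (m n) / real n \<le> \<alpha> + 1 / real n" if "0 < n" for n
        using that m[of n] divide_right_mono[of "\<alpha> * real n - 1" "real (m n)" "real n"]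
          divide_right_mono[of "real (m n)" "\<alpha> * real n + 1" "real n"]
        by (simp add: abs_less_iff add_divide_distrib diff_divide_distrib)
      then show "eventually (\<lambda>n. \<alpha> - 1 / real n \<le> real (m n) / real n) sequentially"
        "eventually (\<lambda>n. real (m n) / real n \<le> \<alpha> + 1 / real n) sequentially"
        by (auto intro: eventually_mono[OF eventually_gt_at_top[of 0]])
    qed
  qed real_asymp+
  have "eventually (\<lambda>n. 0 < n) sequentially" by (rule eventually_gt_at_top)
  moreover have "eventually (\<lambda>n. 0 < real (m n)) sequentially"
    using m_top unfolding filterlim_at_top_dense by (rule spec)
  moreover have "eventually (\<lambda>n. 1 \<le> \<delta> * sqrt (real n)) sequentially"
    using \<delta> by real_asymp
  moreover have "eventually (\<lambda>n. sqrt (\<alpha> * f) - \<delta> < sqrt (real (m n) / real n * (f - \<delta>1))) sequentially"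
    using \<delta>1(2) by (intro order_tendstoD(1)[of _ "sqrt (\<alpha> * (f - \<delta>1))"] tendsto_intros m_ratio)
  ultimately have lower: "eventually (\<lambda>n. L n \<le> good n) sequentially"
  proof eventually_elim
    fix n assume n: "0 < n" and mn: "0 < real (m n)" and large: "1 \<le> \<delta> * sqrt (real n)"
      and ratio: "sqrt (\<alpha> * f) - \<delta> < sqrt (real (m n) / real n * (f - \<delta>1))"
    let ?s = "sqrt (real n)"
    interpret smoothing \<kappa> \<eta> "real n" "(c + 4 * \<delta>) * ?s" "m n"
      using n \<eta> by unfold_locales auto
    have "real (m n) \<le> (\<alpha> + 1) * real n" using m[of n] n by (simp add: algebra_simps abs_less_iff)
    then have "sqrt (real (m n)) \<le> sqrt (\<alpha> + 1) * ?s"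
      by (simp flip: real_sqrt_mult)
    then have "\<eta> / 2 * sqrt (real (m n)) \<le> \<eta> / 2 * (sqrt (\<alpha> + 1) * ?s)"
      using \<eta> by (intro mult_left_mono) auto
    also have "\<dots> = \<delta> * ?s" using \<alpha> by (simp add: \<eta>_def)
    finally have r: "c * ?s + \<eta> / 2 * sqrt (real (m n)) + 1 + \<delta> * ?s \<le> (c + 4 * \<delta>) * ?s - \<delta> * ?s"
      using large by (simp add: algebra_simps)
    have "(sqrt (\<alpha> * f) - \<delta>) * ?s \<le> sqrt (real (m n) / real n * (f - \<delta>1)) * ?s"
      using ratio by (intro mult_right_mono) auto
    also have "\<dots> = sqrt (real (m n) * (f - \<delta>1))" using n by (simp flip: real_sqrt_mult)
    also have "sqrt (\<alpha> * f) = 8 * \<delta> + sqrt (2 / pi) + c" by (simp add: \<delta>_def field_simps)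
    finally have T: "((c + 4 * \<delta>) * ?s + \<delta> * ?s) + ?s * (sqrt (2 / pi) + \<delta>) \<le> sqrt (real (m n) * (f - \<delta>1))"
      using mult_pos_pos[OF \<delta>, of ?s] n by (simp add: algebra_simps)
    have "L n \<le> measure (gauss_PiM ({..m n} \<times> {..n})) {w \<in> space (gauss_PiM ({..m n} \<times> {..n})). (c + 4 * \<delta>) * ?s + \<delta> * ?s
          \<le> sqrt (\<Sum>i<m n. (max 0 (\<kappa> + w (i, n)))\<^sup>2) - (\<Sum>l<n. \<bar>w (m n, l)\<bar>) / ?s}
        * exp (- (2 ^ n * exp (- real n * (\<delta> * ?s))))
      - measure (gauss_PiM ({..m n} \<times> {..n})) {w \<in> space (gauss_PiM ({..m n} \<times> {..n})). \<delta> * ?s \<le> w (m n, n)}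
      - exp (- exp (real n * (\<delta> * ?s)))"
      unfolding L_def V_def using T \<delta> \<delta>1 mn n
      by (intro diff_mono mult_right_mono decoupled_prob_ge corner_prob_le) (auto simp: f_def)
    also have "\<dots> \<le> good n"
      using gordon_prob_bound[OF n r] std_normal_matrix_prob_transfer[OF H, of n "c * ?s" \<kappa>] mn n
      unfolding good_def by simp
    finally show "L n \<le> good n" .
  qed
  have upper: "good n \<le> 1" for n
    unfolding good_def using H[of n] by (intro prob_space.prob_le_1) (simp add: std_normal_matrix_def)
  have "L \<longlonglongrightarrow> (1 - 0 - 0) * 1 - 0 - 0"
    unfolding L_def
  proof (intro tendsto_intros)
    show "(\<lambda>n. V / (real (m n) * \<delta>1\<^sup>2)) \<longlonglongrightarrow> 0"
      using m_top \<delta>1(1)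
      by (intro tendsto_divide_0[OF tendsto_const] filterlim_at_top_imp_at_infinity filterlim_tendsto_pos_mult_at_top[OF tendsto_const, of "\<delta>1\<^sup>2" , simplified mult.commute]) auto
  qed (use \<delta> in real_asymp)+
  then have L: "L \<longlonglongrightarrow> 1" by simp
  have "good \<longlonglongrightarrow> 1"
    by (rule tendsto_sandwich[OF lower _ L tendsto_const]) (use upper in auto)
  then show ?thesis unfolding good_def .
qed

section \<open>The limit for \<open>xi_pm1\<close>, for thresholds of either sign\<close>

theorem theorem6:
  fixes \<alpha> \<kappa> \<epsilon>1m \<epsilon>1n \<epsilon>5g :: real
    and m :: "nat \<Rightarrow> nat"
    and M :: "nat \<Rightarrow> 'a measure"
    and H :: "nat \<Rightarrow> nat \<Rightarrow> nat \<Rightarrow> 'a \<Rightarrow> real"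
    and \<xi>l :: "nat \<Rightarrow> real"
  assumes "\<alpha> > 0"
    and "\<And>n. \<bar>real (m n) - \<alpha> * real n\<bar> < 1"
    and "\<And>n. std_normal_matrix (M n) (m n) n (H n)"
    and "\<epsilon>1m > 0" and "\<epsilon>1n > 0" and "\<epsilon>5g > 0"
    and "\<And>n. n \<ge> 1 \<Longrightarrow>
           (1 - \<epsilon>1m) * sqrt (\<alpha> * f_gar \<kappa>) - (1 + \<epsilon>1n) * sqrt (2 / pi) - \<epsilon>5g
             > \<xi>l n / sqrt (real n)"
  shows "f_gar \<kappa> = \<kappa> * exp (- \<kappa>\<^sup>2 / 2) / sqrt (2 * pi)
                     + (\<kappa>\<^sup>2 + 1) * erfc (- \<kappa> / sqrt 2) / 2
    \<and> (\<lambda>n. \<P>(\<omega> in M n. xi_pm1 \<kappa> (m n) n (\<lambda>i j. H n i j \<omega>) \<ge> \<xi>l n))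
        \<longlonglongrightarrow> 1"
proof
  show "f_gar \<kappa> = \<kappa> * exp (- \<kappa>\<^sup>2 / 2) / sqrt (2 * pi)
      + (\<kappa>\<^sup>2 + 1) * erfc (- \<kappa> / sqrt 2) / 2"
    by (rule f_gar_closed_form)
next
  define A where "A = (1 - \<epsilon>1m) * sqrt (\<alpha> * f_gar \<kappa>) - (1 + \<epsilon>1n) * sqrt (2 / pi) - \<epsilon>5g"
  define N where "N K n \<omega> x = sqrt (\<Sum>i<m n. (max 0 (K - (\<Sum>l<n. H n i l \<omega> * x l)))\<^sup>2)" for K n \<omega> and x :: "nat \<Rightarrow> real"
  define good where "good K c n = {\<omega> \<in> space (M n). \<forall>x\<in>cube_pm1 n. c * sqrt (real n) \<le> N K n \<omega> x}" for K c n
  define target where "target n = {\<omega> \<in> space (M n). \<xi>l n \<le> xi_pm1 \<kappa> (m n) n (\<lambda>i j. H n i j \<omega>)}" for n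
  have \<xi>l: "\<xi>l n \<le> A * sqrt (real n)" if "0 < n" for n
    using assms(7)[of n] that by (simp add: A_def pos_divide_less_eq)
  \<comment> \<open>The two multiplicative corrections only lower \<open>A\<close>, and
    \<open>\<epsilon>5g\<close> remains as a strict gap below the limiting value.\<close>
  have A_le: "A + \<epsilon>5g \<le> sqrt (\<alpha> * f_gar \<kappa>) - sqrt (2 / pi)"
  proof -
    have "0 \<le> \<epsilon>1m * sqrt (\<alpha> * f_gar \<kappa>)" "0 \<le> \<epsilon>1n * sqrt (2 / pi)"
      using assms f_gar_pos[of \<kappa>] by (auto simp: less_imp_le)
    then show ?thesis by (simp add: A_def algebra_simps)
  qed
  have N_pos: "\<exists>i<m n. 0 < K - (\<Sum>l<n. H n i l \<omega> * x l)" if "0 < N K n \<omega> x" for K n \<omega> x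
  proof (rule ccontr)
    assume "\<not> ?thesis"
    then have "K - (\<Sum>l<n. H n i l \<omega> * x l) \<le> 0" if "i < m n" for i
      using that by (meson not_le)
    then have "N K n \<omega> x = 0" unfolding N_def by (auto intro!: sum.neutral max_absorb1)
    with that show False by simp
  qed
  \<comment> \<open>Both signs of the threshold are reduced to one claim: some margin event,
    possibly with another constant \<open>K\<close> in place of \<open>\<kappa>\<close>, has
    probability tending to 1 and eventually implies the target.\<close>
  have "\<exists>K c. c < sqrt (\<alpha> * f_gar K) - sqrt (2 / pi) \<and>
      eventually (\<lambda>n. 0 < m n \<and> good K c n \<subseteq> target n) sequentially"
  proof -
    have ev: "eventually (\<lambda>n. 0 < n \<and> 0 < m n) sequentially"
    proof -
      have "eventually (\<lambda>n. 1 < \<alpha> * real n) sequentially" using assms(1) by real_asymp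
      then show ?thesis using eventually_gt_at_top[of 0]
      proof eventually_elim
        case (elim n)
        then have "0 < real (m n)" using assms(2)[of n] by (simp add: abs_less_iff)
        then show ?case using elim by simp
      qed
    qed
    show ?thesis
    \<comment> \<open>With a positive level the norm of the positive part is positive, so some
      margin is positive and the inner maximum equals that norm.\<close>
    proof (cases "0 < A + \<epsilon>5g / 2")
      case True
      show ?thesis
      proof (intro exI conjI)
        show "A + \<epsilon>5g / 2 < sqrt (\<alpha> * f_gar \<kappa>) - sqrt (2 / pi)" using A_le assms(6) by simp
        show "eventually (\<lambda>n. 0 < m n \<and> good \<kappa> (A + \<epsilon>5g / 2) n \<subseteq> target n) sequentially"
          using ev
        proof eventually_elim
          fix n assume n: "0 < n \<and> 0 < m n"
          have "0 < (A + \<epsilon>5g / 2) * sqrt (real n)" using True n by simp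
          moreover have "\<xi>l n \<le> (A + \<epsilon>5g / 2) * sqrt (real n)"
            using \<xi>l[of n] n assms(6) by (simp add: algebra_simps add_increasing2)
          ultimately have "good \<kappa> (A + \<epsilon>5g / 2) n \<subseteq> target n"
            using n N_pos[of \<kappa> n] unfolding good_def target_def
            by (auto simp: xi_pm1_ge_iff N_def[symmetric] intro: order.trans) (meson less_le_trans)+
          then show "0 < m n \<and> good \<kappa> (A + \<epsilon>5g / 2) n \<subseteq> target n" using n by simp
        qed
      qed
    next
      case False
      \<comment> \<open>With this value \<open>f_gar_ge\<close> gives
        \<open>\<alpha> * f_gar K \<ge> 2\<close>, which exceeds \<open>2 / pi\<close>, so a
        positive level \<open>c\<close> is available for \<open>K\<close>.\<close>
      define K where "K = 2 / sqrt \<alpha>"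
      have "2 \<le> \<alpha> * f_gar K"
        using f_gar_ge[of K] assms(1) mult_left_mono[of "K\<^sup>2 / 2" "f_gar K" \<alpha>] by (simp add: K_def power_divide)
      moreover have "2 / pi < 2" using pi_gt3 by (simp add: divide_less_eq)
      ultimately have K: "sqrt (2 / pi) < sqrt (\<alpha> * f_gar K)" by (intro real_sqrt_less_mono) simp
      define c where "c = (sqrt (\<alpha> * f_gar K) - sqrt (2 / pi)) / 2"
      have c: "0 < c" "c < sqrt (\<alpha> * f_gar K) - sqrt (2 / pi)" using K by (simp_all add: c_def)
      have A: "A < 0" using False assms(6) by simp
      \<comment> \<open>The shift from \<open>K\<close> back to \<open>\<kappa>\<close> is a
        constant, while the threshold is at most the negative \<open>A\<close> times the growing
        root of \<open>n\<close>.\<close>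
      then have "eventually (\<lambda>n. A * sqrt (real n) \<le> \<kappa> - K) sequentially" by real_asymp
      with ev have "eventually (\<lambda>n. 0 < m n \<and> good K c n \<subseteq> target n) sequentially"
      proof eventually_elim
        fix n assume n: "0 < n \<and> 0 < m n" and AK: "A * sqrt (real n) \<le> \<kappa> - K"
        have le: "\<xi>l n \<le> \<kappa> - K" using \<xi>l[of n] n AK by simp
        have "\<xi>l n \<le> 0" using \<xi>l[of n] n A mult_nonpos_nonneg[of A "sqrt (real n)"] by simp
        \<comment> \<open>A norm is nonnegative, so the branch with a positive margin holds
          trivially. Only the branch in which all margins are nonpositive needs the row found
          below.\<close>
        then have nn: "\<xi>l n \<le> sqrt (\<Sum>i<m n. y i ^ 2)" for y :: "nat \<Rightarrow> real"
          by (rule order.trans) (simp add: sum_nonneg)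
        have "good K c n \<subseteq> target n"
        proof
          fix \<omega> assume \<omega>: "\<omega> \<in> good K c n"
          have "\<exists>i<m n. \<xi>l n \<le> \<kappa> - (\<Sum>l<n. H n i l \<omega> * x l)" if "x \<in> cube_pm1 n" for x
          proof -
            have "0 < c * sqrt (real n)" using c n by simp
            also have "\<dots> \<le> N K n \<omega> x" using \<omega> that by (simp add: good_def)
            finally obtain i where "i < m n" "0 < K - (\<Sum>l<n. H n i l \<omega> * x l)" using N_pos by blast
            with le show ?thesis by (intro exI[of _ i]) simp
          qed
          then show "\<omega> \<in> target n" using \<omega> n nn by (simp add: target_def good_def xi_pm1_ge_iff)
        qed
        then show "0 < m n \<and> good K c n \<subseteq> target n" using n by simp
      qed
      with c show ?thesis by blast
    qed
  qed
  then obtain K c where c: "c < sqrt (\<alpha> * f_gar K) - sqrt (2 / pi)"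
    and ev: "eventually (\<lambda>n. 0 < m n \<and> good K c n \<subseteq> target n) sequentially" by blast
  have lim: "(\<lambda>n. measure (M n) (good K c n)) \<longlonglongrightarrow> 1"
    using margin_prob_tendsto_1[OF assms(1,2,3) c] unfolding good_def N_def .
  have prob: "prob_space (M n)" for n using assms(3)[of n] by (simp add: std_normal_matrix_def)
  \<comment> \<open>Monotonicity of the measure needs the larger event to be measurable; through
    \<open>xi_pm1_ge_iff\<close> it is a finite combination of measurable conditions.\<close>
  have target_meas: "target n \<in> sets (M n)" if "0 < m n" for n
  proof -
    have [measurable]: "H n i l \<in> borel_measurable (M n)" if "i < m n" "l < n" for i l
      using std_normal_matrix_measurable[OF assms(3)] that .
    show ?thesis
      unfolding target_def xi_pm1_ge_iff[OF that] using finite_cube_pm1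
      by (intro sets.sets_Collect_finite_All) (measurable; simp)+
  qed
  have "(\<lambda>n. measure (M n) (target n)) \<longlonglongrightarrow> 1"
  proof (rule tendsto_sandwich[OF _ _ lim tendsto_const])
    show "eventually (\<lambda>n. measure (M n) (good K c n) \<le> measure (M n) (target n)) sequentially"
      using ev by eventually_elim
        (use target_meas prob in \<open>auto intro!: finite_measure.finite_measure_mono simp: prob_space_def\<close>)
    show "eventually (\<lambda>n. measure (M n) (target n) \<le> 1) sequentially"
      by (intro always_eventually allI prob_space.prob_le_1 prob)
  qed
  then show "(\<lambda>n. \<P>(\<omega> in M n. xi_pm1 \<kappa> (m n) n (\<lambda>i j. H n i j \<omega>) \<ge> \<xi>l n)) \<longlonglongrightarrow> 1"
    unfolding target_def .
qed

end
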